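(* Let $R$ be a commutative ring, $L$ an $R$-Lie algebra, and let $(M\xrightarrow{\mu}L,\psi_M)$ and $(N\xrightarrow{\nu}L,\psi_N)$ be crossed modules of $R$-Lie algebras. Let $M\bowtie N$ be the Peiffer product of $M$ and $N$ with respect to the induced actions ${}^{m}n:=\psi_N(\mu(m),n)$ and ${}^{n}m:=\psi_M(\nu(n),m)$, let $\psi_{M\bowtie N}$ be the induced action of $L$ on $M\bowtie N$, and let $\overline{(\mu,\nu)}\colon M\bowtie N\to L$ be the morphism induced by $\mu$ and $\nu$. Then $(M\bowtie N\xrightarrow{\overline{(\mu,\nu)}}L,\psi_{M\bowtie N})$ is a crossed module of $R$-Lie algebras.
   Context: An $R$-Lie algebra is an $R$-module with an $R$-bilinear bracket satisfying $[x,x]=0$ and the Jacobi identity. $M+N$ denotes the coproduct in the category of $R$-Lie algebras; $M$ and $N$ are identified with their images in $M+N$. An action of an $R$-Lie algebra $P$ on an $R$-Lie algebra $M$ is an $R$-bilinear map $\psi\colon P\times M\to M$, $(p,m)\mapsto {}^{p}m$, such that ${}^{[p,p']}m={}^{p}({}^{p'}m)-{}^{p'}({}^{p}m)$ and ${}^{p}[m,m']=[{}^{p}m,m']+[m,{}^{p}m']$. A crossed module of $R$-Lie algebras $(M\xrightarrow{\partial}P,\psi)$ consists of a Lie algebra morphism $\partial\colon M\to P$ and an action $\psi$ of $P$ on $M$ such that ${}^{\partial(m)}m'=[m,m']$ and $\partial({}^{p}m)=[p,\partial(m)]$ for all $m,m'\in M$, $p\in P$. Peiffer product: given an action of $M$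 on $N$ and an action of $N$ on $M$, let $K$ be the ideal of $M+N$ generated by the elements ${}^{n}m-[n,m]$ and ${}^{m}n-[m,n]$ for $m\in M$, $n\in N$; then $M\bowtie N:=(M+N)/K$ with quotient map $q\colon M+N\to M\bowtie N$. The actions of $L$ on $M$ and $N$ extend uniquely to an action of $L$ on $M+N$, determined by linearity and by ${}^{l}[s_1,s_2]=[{}^{l}s_1,s_2]+[s_1,{}^{l}s_2]$. This action maps $K$ into $K$, and $\psi_{M\bowtie N}$ is the induced action of $L$ on $M\bowtie N$: ${}^{l}q(s)=q({}^{l}s)$. The morphism $\overline{(\mu,\nu)}\colon M\bowtie N\to L$ is the unique Lie algebra morphism such that $\overline{(\mu,\nu)}(q(m))=\mu(m)$ and $\overline{(\mu,\nu)}(q(n))=\nu(n)$ for $m\in M$, $n\in N$. *)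

theory Defs
  imports "HOL-Algebra.Module" "HOL-Algebra.QuotRing"
begin

section \<open>Lie algebras over a commutative ring\<close>

text \<open>
  A Lie algebra is carried by a record of type \<^typ>\<open>('r, 'a) module\<close> whose multiplication
  field is the Lie bracket: \<open>x \<otimes>\<^bsub>L\<^esub> y\<close> stands for $[x,y]$. The field \<open>one\<close> plays no role
  (and \<^locale>\<open>module\<close> does not refer to it).
\<close>

locale lie_algebra = module R L for R (structure) and L (structure) +
  assumes bracket_closed [simp, intro]:
      "\<lbrakk>x \<in> carrier L; y \<in> carrier L\<rbrakk> \<Longrightarrow> x \<otimes>\<^bsub>L\<^esub> y \<in> carrier L"
    and bracket_add_l:
      "\<lbrakk>x \<in> carrier L; y \<in> carrier L; z \<in> carrier L\<rbrakk>
        \<Longrightarrow> (x \<oplus>\<^bsub>L\<^esub> y) \<otimes>\<^bsub>L\<^esub> z = (x \<otimes>\<^bsub>L\<^esub> z) \<oplus>\<^bsub>L\<^esub> (y \<otimes>\<^bsub>L\<^esub> z)"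
    and bracket_add_r:
      "\<lbrakk>x \<in> carrier L; y \<in> carrier L; z \<in> carrier L\<rbrakk>
        \<Longrightarrow> x \<otimes>\<^bsub>L\<^esub> (y \<oplus>\<^bsub>L\<^esub> z) = (x \<otimes>\<^bsub>L\<^esub> y) \<oplus>\<^bsub>L\<^esub> (x \<otimes>\<^bsub>L\<^esub> z)"
    and bracket_smult_l:
      "\<lbrakk>r \<in> carrier R; x \<in> carrier L; y \<in> carrier L\<rbrakk>
        \<Longrightarrow> (r \<odot>\<^bsub>L\<^esub> x) \<otimes>\<^bsub>L\<^esub> y = r \<odot>\<^bsub>L\<^esub> (x \<otimes>\<^bsub>L\<^esub> y)"
    and bracket_smult_r:
      "\<lbrakk>r \<in> carrier R; x \<in> carrier L; y \<in> carrier L\<rbrakk>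
        \<Longrightarrow> x \<otimes>\<^bsub>L\<^esub> (r \<odot>\<^bsub>L\<^esub> y) = r \<odot>\<^bsub>L\<^esub> (x \<otimes>\<^bsub>L\<^esub> y)"
    and bracket_self [simp]:
      "x \<in> carrier L \<Longrightarrow> x \<otimes>\<^bsub>L\<^esub> x = \<zero>\<^bsub>L\<^esub>"
    and jacobi:
      "\<lbrakk>x \<in> carrier L; y \<in> carrier L; z \<in> carrier L\<rbrakk>
        \<Longrightarrow> (x \<otimes>\<^bsub>L\<^esub> (y \<otimes>\<^bsub>L\<^esub> z)) \<oplus>\<^bsub>L\<^esub> (y \<otimes>\<^bsub>L\<^esub> (z \<otimes>\<^bsub>L\<^esub> x)) \<oplus>\<^bsub>L\<^esub> (z \<otimes>\<^bsub>L\<^esub> (x \<otimes>\<^bsub>L\<^esub> y)) = \<zero>\<^bsub>L\<^esub>"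

definition lie_hom ::
    "('r, 'x) ring_scheme \<Rightarrow> ('r, 'a, 'y) module_scheme \<Rightarrow> ('r, 'b, 'z) module_scheme \<Rightarrow> ('a \<Rightarrow> 'b) set"
  where "lie_hom R A B =
    {f \<in> carrier A \<rightarrow> carrier B.
       (\<forall>x \<in> carrier A. \<forall>y \<in> carrier A. f (x \<oplus>\<^bsub>A\<^esub> y) = f x \<oplus>\<^bsub>B\<^esub> f y) \<and>
       (\<forall>r \<in> carrier R. \<forall>x \<in> carrier A. f (r \<odot>\<^bsub>A\<^esub> x) = r \<odot>\<^bsub>B\<^esub> f x) \<and>
       (\<forall>x \<in> carrier A. \<forall>y \<in> carrier A. f (x \<otimes>\<^bsub>A\<^esub> y) = f x \<otimes>\<^bsub>B\<^esub> f y)}"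

locale lie_action =
  P?: lie_algebra R P + M?: lie_algebra R M
  for R (structure) and P (structure) and M (structure) +
  fixes \<psi>
  assumes act_closed:
      "\<lbrakk>p \<in> carrier P; m \<in> carrier M\<rbrakk> \<Longrightarrow> \<psi> p m \<in> carrier M"
    and act_add_l:
      "\<lbrakk>p \<in> carrier P; p' \<in> carrier P; m \<in> carrier M\<rbrakk>
        \<Longrightarrow> \<psi> (p \<oplus>\<^bsub>P\<^esub> p') m = \<psi> p m \<oplus>\<^bsub>M\<^esub> \<psi> p' m"
    and act_add_r:
      "\<lbrakk>p \<in> carrier P; m \<in> carrier M; m' \<in> carrier M\<rbrakk>
        \<Longrightarrow> \<psi> p (m \<oplus>\<^bsub>M\<^esub> m') = \<psi> p m \<oplus>\<^bsub>M\<^esub> \<psi> p m'"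
    and act_smult_l:
      "\<lbrakk>r \<in> carrier R; p \<in> carrier P; m \<in> carrier M\<rbrakk>
        \<Longrightarrow> \<psi> (r \<odot>\<^bsub>P\<^esub> p) m = r \<odot>\<^bsub>M\<^esub> \<psi> p m"
    and act_smult_r:
      "\<lbrakk>r \<in> carrier R; p \<in> carrier P; m \<in> carrier M\<rbrakk>
        \<Longrightarrow> \<psi> p (r \<odot>\<^bsub>M\<^esub> m) = r \<odot>\<^bsub>M\<^esub> \<psi> p m"
    and act_bracket_l:
      "\<lbrakk>p \<in> carrier P; p' \<in> carrier P; m \<in> carrier M\<rbrakk>
        \<Longrightarrow> \<psi> (p \<otimes>\<^bsub>P\<^esub> p') m = \<psi> p (\<psi> p' m) \<ominus>\<^bsub>M\<^esub> \<psi> p' (\<psi> p m)"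
    and act_bracket_r:
      "\<lbrakk>p \<in> carrier P; m \<in> carrier M; m' \<in> carrier M\<rbrakk>
        \<Longrightarrow> \<psi> p (m \<otimes>\<^bsub>M\<^esub> m') = (\<psi> p m \<otimes>\<^bsub>M\<^esub> m') \<oplus>\<^bsub>M\<^esub> (m \<otimes>\<^bsub>M\<^esub> \<psi> p m')"

locale lie_crossed_module =
  lie_action R P M \<psi>
  for R (structure) and M (structure) and P (structure)
    and \<delta> and \<psi> +
  assumes boundary_hom: "\<delta> \<in> lie_hom R M P"
    and peiffer_identity:
      "\<lbrakk>m \<in> carrier M; m' \<in> carrier M\<rbrakk> \<Longrightarrow> \<psi> (\<delta> m) m' = m \<otimes>\<^bsub>M\<^esub> m'"
    and boundary_equivariant:
      "\<lbrakk>p \<in> carrier P; m \<in> carrier M\<rbrakk> \<Longrightarrow> \<delta> (\<psi> p m) = p \<otimes>\<^bsub>P\<^esub> \<delta> m"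


section \<open>Ideals and quotients\<close>

definition lie_ideal ::
    "'a set \<Rightarrow> ('r, 'x) ring_scheme \<Rightarrow> ('r, 'a, 'y) module_scheme \<Rightarrow> bool"
  where "lie_ideal I R A \<longleftrightarrow>
    submodule I R A \<and> (\<forall>x \<in> carrier A. \<forall>y \<in> I. x \<otimes>\<^bsub>A\<^esub> y \<in> I)"

definition gen_lie_ideal ::
    "('r, 'x) ring_scheme \<Rightarrow> ('r, 'a, 'y) module_scheme \<Rightarrow> 'a set \<Rightarrow> 'a set"
  where "gen_lie_ideal R A S = \<Inter>{I. lie_ideal I R A \<and> S \<subseteq> I}"

definition lie_quot :: "('r, 'a, 'y) module_scheme \<Rightarrow> 'a set \<Rightarrow> ('r, 'a set) module"
  where "lie_quot A I =
    \<lparr>carrier = a_rcosets\<^bsub>A\<^esub> I, mult = rcoset_mult A I, one = undefined,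
     zero = I, add = set_add A, smult = (\<lambda>r X. \<Union>x\<in>X. I +>\<^bsub>A\<^esub> (r \<odot>\<^bsub>A\<^esub> x))\<rparr>"


section \<open>The coproduct of two Lie algebras\<close>

text \<open>
  The coproduct is constructed as in universal algebra: formal Lie expressions in elements of
  \<open>M\<close> and \<open>N\<close>, modulo the congruence generated by the axioms of a Lie algebra and
  by the operations of \<open>M\<close> and \<open>N\<close>. \<open>lie_coprod_universal\<close> below is its universal property.
\<close>

datatype ('r, 'm, 'n) lie_term =
    TInl 'm
  | TInr 'n
  | TZero
  | TAdd "('r, 'm, 'n) lie_term" "('r, 'm, 'n) lie_term"
  | TSmult 'r "('r, 'm, 'n) lie_term"
  | TBr "('r, 'm, 'n) lie_term" "('r, 'm, 'n) lie_term"

primrec lie_term_wf ::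
    "('r, 'x) ring_scheme \<Rightarrow> ('r, 'm, 'y) module_scheme \<Rightarrow> ('r, 'n, 'z) module_scheme
      \<Rightarrow> ('r, 'm, 'n) lie_term \<Rightarrow> bool"
  where
    "lie_term_wf R M N (TInl m) \<longleftrightarrow> m \<in> carrier M"
  | "lie_term_wf R M N (TInr n) \<longleftrightarrow> n \<in> carrier N"
  | "lie_term_wf R M N TZero \<longleftrightarrow> True"
  | "lie_term_wf R M N (TAdd s t) \<longleftrightarrow> lie_term_wf R M N s \<and> lie_term_wf R M N t"
  | "lie_term_wf R M N (TSmult r s) \<longleftrightarrow> r \<in> carrier R \<and> lie_term_wf R M N s"
  | "lie_term_wf R M N (TBr s t) \<longleftrightarrow> lie_term_wf R M N s \<and> lie_term_wf R M N t"

abbreviation lie_terms ::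
    "('r, 'x) ring_scheme \<Rightarrow> ('r, 'm, 'y) module_scheme \<Rightarrow> ('r, 'n, 'z) module_scheme
      \<Rightarrow> ('r, 'm, 'n) lie_term set"
  where "lie_terms R M N \<equiv> {t. lie_term_wf R M N t}"

inductive_set lie_cong ::
    "('r, 'x) ring_scheme \<Rightarrow> ('r, 'm, 'y) module_scheme \<Rightarrow> ('r, 'n, 'z) module_scheme
      \<Rightarrow> (('r, 'm, 'n) lie_term \<times> ('r, 'm, 'n) lie_term) set"
  for R :: "('r, 'x) ring_scheme"
    and M :: "('r, 'm, 'y) module_scheme"
    and N :: "('r, 'n, 'z) module_scheme"
  where
    cong_refl: "s \<in> lie_terms R M N \<Longrightarrow> (s, s) \<in> lie_cong R M N"
  | cong_sym: "(s, t) \<in> lie_cong R M N \<Longrightarrow> (t, s) \<in> lie_cong R M N"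
  | cong_trans: "\<lbrakk>(s, t) \<in> lie_cong R M N; (t, u) \<in> lie_cong R M N\<rbrakk> \<Longrightarrow> (s, u) \<in> lie_cong R M N"
  | cong_Add: "\<lbrakk>(s, s') \<in> lie_cong R M N; (t, t') \<in> lie_cong R M N\<rbrakk>
      \<Longrightarrow> (TAdd s t, TAdd s' t') \<in> lie_cong R M N"
  | cong_Smult: "\<lbrakk>r \<in> carrier R; (s, s') \<in> lie_cong R M N\<rbrakk>
      \<Longrightarrow> (TSmult r s, TSmult r s') \<in> lie_cong R M N"
  | cong_Br: "\<lbrakk>(s, s') \<in> lie_cong R M N; (t, t') \<in> lie_cong R M N\<rbrakk>
      \<Longrightarrow> (TBr s t, TBr s' t') \<in> lie_cong R M N"
  | cong_add_assoc: "\<lbrakk>s \<in> lie_terms R M N; t \<in> lie_terms R M N; u \<in> lie_terms R M N\<rbrakk>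
      \<Longrightarrow> (TAdd (TAdd s t) u, TAdd s (TAdd t u)) \<in> lie_cong R M N"
  | cong_add_comm: "\<lbrakk>s \<in> lie_terms R M N; t \<in> lie_terms R M N\<rbrakk>
      \<Longrightarrow> (TAdd s t, TAdd t s) \<in> lie_cong R M N"
  | cong_add_zero: "s \<in> lie_terms R M N \<Longrightarrow> (TAdd TZero s, s) \<in> lie_cong R M N"
  | cong_add_neg: "s \<in> lie_terms R M N
      \<Longrightarrow> (TAdd (TSmult (\<ominus>\<^bsub>R\<^esub> \<one>\<^bsub>R\<^esub>) s) s, TZero) \<in> lie_cong R M N"
  | cong_smult_add_l: "\<lbrakk>a \<in> carrier R; b \<in> carrier R; s \<in> lie_terms R M N\<rbrakk>
      \<Longrightarrow> (TSmult (a \<oplus>\<^bsub>R\<^esub> b) s, TAdd (TSmult a s) (TSmult b s)) \<in> lie_cong R M N"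
  | cong_smult_add_r: "\<lbrakk>a \<in> carrier R; s \<in> lie_terms R M N; t \<in> lie_terms R M N\<rbrakk>
      \<Longrightarrow> (TSmult a (TAdd s t), TAdd (TSmult a s) (TSmult a t)) \<in> lie_cong R M N"
  | cong_smult_mult: "\<lbrakk>a \<in> carrier R; b \<in> carrier R; s \<in> lie_terms R M N\<rbrakk>
      \<Longrightarrow> (TSmult (a \<otimes>\<^bsub>R\<^esub> b) s, TSmult a (TSmult b s)) \<in> lie_cong R M N"
  | cong_smult_1: "s \<in> lie_terms R M N \<Longrightarrow> (TSmult \<one>\<^bsub>R\<^esub> s, s) \<in> lie_cong R M N"
  | cong_br_add_l: "\<lbrakk>s \<in> lie_terms R M N; t \<in> lie_terms R M N; u \<in> lie_terms R M N\<rbrakk>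
      \<Longrightarrow> (TBr (TAdd s t) u, TAdd (TBr s u) (TBr t u)) \<in> lie_cong R M N"
  | cong_br_add_r: "\<lbrakk>s \<in> lie_terms R M N; t \<in> lie_terms R M N; u \<in> lie_terms R M N\<rbrakk>
      \<Longrightarrow> (TBr s (TAdd t u), TAdd (TBr s t) (TBr s u)) \<in> lie_cong R M N"
  | cong_br_smult_l: "\<lbrakk>a \<in> carrier R; s \<in> lie_terms R M N; t \<in> lie_terms R M N\<rbrakk>
      \<Longrightarrow> (TBr (TSmult a s) t, TSmult a (TBr s t)) \<in> lie_cong R M N"
  | cong_br_smult_r: "\<lbrakk>a \<in> carrier R; s \<in> lie_terms R M N; t \<in> lie_terms R M N\<rbrakk>
      \<Longrightarrow> (TBr s (TSmult a t), TSmult a (TBr s t)) \<in> lie_cong R M N"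
  | cong_br_self: "s \<in> lie_terms R M N \<Longrightarrow> (TBr s s, TZero) \<in> lie_cong R M N"
  | cong_br_jacobi: "\<lbrakk>s \<in> lie_terms R M N; t \<in> lie_terms R M N; u \<in> lie_terms R M N\<rbrakk>
      \<Longrightarrow> (TAdd (TAdd (TBr s (TBr t u)) (TBr t (TBr u s))) (TBr u (TBr s t)), TZero)
            \<in> lie_cong R M N"
  | cong_inl_add: "\<lbrakk>m \<in> carrier M; m' \<in> carrier M\<rbrakk>
      \<Longrightarrow> (TInl (m \<oplus>\<^bsub>M\<^esub> m'), TAdd (TInl m) (TInl m')) \<in> lie_cong R M N"
  | cong_inl_smult: "\<lbrakk>a \<in> carrier R; m \<in> carrier M\<rbrakk>
      \<Longrightarrow> (TInl (a \<odot>\<^bsub>M\<^esub> m), TSmult a (TInl m)) \<in> lie_cong R M N"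
  | cong_inl_br: "\<lbrakk>m \<in> carrier M; m' \<in> carrier M\<rbrakk>
      \<Longrightarrow> (TInl (m \<otimes>\<^bsub>M\<^esub> m'), TBr (TInl m) (TInl m')) \<in> lie_cong R M N"
  | cong_inr_add: "\<lbrakk>n \<in> carrier N; n' \<in> carrier N\<rbrakk>
      \<Longrightarrow> (TInr (n \<oplus>\<^bsub>N\<^esub> n'), TAdd (TInr n) (TInr n')) \<in> lie_cong R M N"
  | cong_inr_smult: "\<lbrakk>a \<in> carrier R; n \<in> carrier N\<rbrakk>
      \<Longrightarrow> (TInr (a \<odot>\<^bsub>N\<^esub> n), TSmult a (TInr n)) \<in> lie_cong R M N"
  | cong_inr_br: "\<lbrakk>n \<in> carrier N; n' \<in> carrier N\<rbrakk>
      \<Longrightarrow> (TInr (n \<otimes>\<^bsub>N\<^esub> n'), TBr (TInr n) (TInr n')) \<in> lie_cong R M N"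

definition lie_class ::
    "('r, 'x) ring_scheme \<Rightarrow> ('r, 'm, 'y) module_scheme \<Rightarrow> ('r, 'n, 'z) module_scheme
      \<Rightarrow> ('r, 'm, 'n) lie_term \<Rightarrow> ('r, 'm, 'n) lie_term set"
  where "lie_class R M N s = lie_cong R M N `` {s}"

definition lie_coprod ::
    "('r, 'x) ring_scheme \<Rightarrow> ('r, 'm, 'y) module_scheme \<Rightarrow> ('r, 'n, 'z) module_scheme
      \<Rightarrow> ('r, ('r, 'm, 'n) lie_term set) module"
  where "lie_coprod R M N =
    \<lparr>carrier = lie_terms R M N // lie_cong R M N,
     mult = (\<lambda>X Y. \<Union>s\<in>X. \<Union>t\<in>Y. lie_class R M N (TBr s t)),
     one = undefined,
     zero = lie_class R M N TZero,
     add = (\<lambda>X Y. \<Union>s\<in>X. \<Union>t\<in>Y. lie_class R M N (TAdd s t)),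
     smult = (\<lambda>r X. \<Union>s\<in>X. lie_class R M N (TSmult r s))\<rparr>"

definition lie_inl ::
    "('r, 'x) ring_scheme \<Rightarrow> ('r, 'm, 'y) module_scheme \<Rightarrow> ('r, 'n, 'z) module_scheme
      \<Rightarrow> 'm \<Rightarrow> ('r, 'm, 'n) lie_term set"
  where "lie_inl R M N m = lie_class R M N (TInl m)"

definition lie_inr ::
    "('r, 'x) ring_scheme \<Rightarrow> ('r, 'm, 'y) module_scheme \<Rightarrow> ('r, 'n, 'z) module_scheme
      \<Rightarrow> 'n \<Rightarrow> ('r, 'm, 'n) lie_term set"
  where "lie_inr R M N n = lie_class R M N (TInr n)"

primrec lie_eval ::
    "('r, 'c, 'w) module_scheme \<Rightarrow> ('m \<Rightarrow> 'c) \<Rightarrow> ('n \<Rightarrow> 'c) \<Rightarrow> ('r, 'm, 'n) lie_term \<Rightarrow> 'c"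
  where
    "lie_eval T f g (TInl m) = f m"
  | "lie_eval T f g (TInr n) = g n"
  | "lie_eval T f g TZero = \<zero>\<^bsub>T\<^esub>"
  | "lie_eval T f g (TAdd s t) = lie_eval T f g s \<oplus>\<^bsub>T\<^esub> lie_eval T f g t"
  | "lie_eval T f g (TSmult r s) = r \<odot>\<^bsub>T\<^esub> lie_eval T f g s"
  | "lie_eval T f g (TBr s t) = lie_eval T f g s \<otimes>\<^bsub>T\<^esub> lie_eval T f g t"

text \<open>
  The morphism from the coproduct to \<open>T\<close> induced by \<open>f\<close> and \<open>g\<close>. Like the other maps below that
  are obtained on a quotient, it is defined through all representatives of its argument.
\<close>

definition lie_copair ::
    "('r, 'c, 'w) module_scheme \<Rightarrow> ('m \<Rightarrow> 'c) \<Rightarrow> ('n \<Rightarrow> 'c) \<Rightarrow> ('r, 'm, 'n) lie_term set \<Rightarrow> 'c"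
  where "lie_copair T f g X = the_elem (lie_eval T f g ` X)"

text \<open>
  Actions \<open>\<phi>\<close>, \<open>\<chi>\<close> of a Lie algebra on \<open>M\<close> and on \<open>N\<close> extend to the coproduct by derivations;
  \<open>lie_coprod_action\<close> below says that this is the unique action extending them.
\<close>

primrec lie_term_act ::
    "('l \<Rightarrow> 'm \<Rightarrow> 'm) \<Rightarrow> ('l \<Rightarrow> 'n \<Rightarrow> 'n) \<Rightarrow> 'l \<Rightarrow> ('r, 'm, 'n) lie_term \<Rightarrow> ('r, 'm, 'n) lie_term"
  where
    "lie_term_act \<phi> \<chi> l (TInl m) = TInl (\<phi> l m)"
  | "lie_term_act \<phi> \<chi> l (TInr n) = TInr (\<chi> l n)"
  | "lie_term_act \<phi> \<chi> l TZero = TZero"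
  | "lie_term_act \<phi> \<chi> l (TAdd s t) = TAdd (lie_term_act \<phi> \<chi> l s) (lie_term_act \<phi> \<chi> l t)"
  | "lie_term_act \<phi> \<chi> l (TSmult r s) = TSmult r (lie_term_act \<phi> \<chi> l s)"
  | "lie_term_act \<phi> \<chi> l (TBr s t) =
       TAdd (TBr (lie_term_act \<phi> \<chi> l s) t) (TBr s (lie_term_act \<phi> \<chi> l t))"

definition lie_coprod_act ::
    "('r, 'x) ring_scheme \<Rightarrow> ('r, 'm, 'y) module_scheme \<Rightarrow> ('r, 'n, 'z) module_scheme
      \<Rightarrow> ('l \<Rightarrow> 'm \<Rightarrow> 'm) \<Rightarrow> ('l \<Rightarrow> 'n \<Rightarrow> 'n)
      \<Rightarrow> 'l \<Rightarrow> ('r, 'm, 'n) lie_term set \<Rightarrow> ('r, 'm, 'n) lie_term set"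
  where "lie_coprod_act R M N \<phi> \<chi> l X = (\<Union>s\<in>X. lie_class R M N (lie_term_act \<phi> \<chi> l s))"


text \<open>
  Well-definedness of the operations on classes, the universal property of the coproduct, and
  existence and uniqueness of the extended action.
\<close>

lemma lie_cong_wf:
  assumes "lie_algebra R M" "lie_algebra R N" "(s, t) \<in> lie_cong R M N"
  shows "lie_term_wf R M N s \<and> lie_term_wf R M N t"
proof -
  interpret M: lie_algebra R M by fact
  interpret N: lie_algebra R N by fact
  show ?thesis using assms(3) by induction auto
qed

lemma equiv_lie_cong:
  assumes "lie_algebra R M" "lie_algebra R N"
  shows "equiv (lie_terms R M N) (lie_cong R M N)"
  using lie_cong_wf[OF assms]
  by (intro equivI refl_onI symI transI) (auto intro: cong_refl cong_sym cong_trans)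

context
  fixes R :: "('r, 'x) ring_scheme" and M :: "('r, 'm, 'y) module_scheme"
    and N :: "('r, 'n, 'z) module_scheme"
  assumes M: "lie_algebra R M" and N: "lie_algebra R N"
begin

interpretation M: lie_algebra R M by (rule M)
interpretation N: lie_algebra R N by (rule N)

private abbreviation "C \<equiv> lie_coprod R M N"
private abbreviation "cls \<equiv> lie_class R M N"
private abbreviation "wft \<equiv> lie_term_wf R M N"

private lemma eqv: "equiv (lie_terms R M N) (lie_cong R M N)"
  by (rule equiv_lie_cong[OF M N])

private lemma cls_eqI: "(s, t) \<in> lie_cong R M N \<Longrightarrow> cls s = cls t"
  unfolding lie_class_def by (rule equiv_class_eq[OF eqv])

private lemma cls_eq_iff: "wft s \<Longrightarrow> wft t \<Longrightarrow> cls s = cls t \<longleftrightarrow> (s, t) \<in> lie_cong R M N"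
  unfolding lie_class_def by (rule eq_equiv_class_iff[OF eqv]) auto

private lemma carrier_C: "carrier C = {cls s | s. wft s}"
  by (auto simp: lie_coprod_def quotient_def lie_class_def)

private lemma in_cls [simp]: "t \<in> cls s \<longleftrightarrow> (s, t) \<in> lie_cong R M N"
  by (simp add: lie_class_def)

private lemma zero_closed_C [simp, intro]: "\<zero>\<^bsub>C\<^esub> \<in> carrier C"
  unfolding lie_coprod_def by (auto simp: lie_class_def intro!: quotientI)

private lemma cls_in [simp, intro]: "wft s \<Longrightarrow> cls s \<in> carrier C"
  by (auto simp: carrier_C)

private lemma cls_lift:
  assumes "wft s" "\<And>t. (s, t) \<in> lie_cong R M N \<Longrightarrow> Y t = Y s"
  shows "(\<Union>t\<in>cls s. Y t) = Y s"
proof -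
  have "s \<in> cls s" using assms(1) by (simp add: cong_refl)
  moreover have "Y t = Y s" if "t \<in> cls s" for t using that assms(2) by simp
  ultimately show ?thesis by (intro UN_constant_eq) blast+
qed

private lemma add_C [simp]:
  assumes "wft s" "wft t"
  shows "cls s \<oplus>\<^bsub>C\<^esub> cls t = cls (TAdd s t)"
proof -
  have "cls s \<oplus>\<^bsub>C\<^esub> cls t = (\<Union>s'\<in>cls s. \<Union>t'\<in>cls t. cls (TAdd s' t'))"
    by (simp add: lie_coprod_def)
  also have "\<dots> = (\<Union>s'\<in>cls s. cls (TAdd s' t))"
    using assms by (intro SUP_cong refl cls_lift cls_eqI cong_Add) (auto intro: cong_sym cong_refl dest: lie_cong_wf[OF M N])
  also have "\<dots> = cls (TAdd s t)"
    using assms by (intro cls_lift cls_eqI cong_Add) (auto intro: cong_sym cong_refl)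
  finally show ?thesis .
qed

private lemma mult_C [simp]:
  assumes "wft s" "wft t"
  shows "cls s \<otimes>\<^bsub>C\<^esub> cls t = cls (TBr s t)"
proof -
  have "cls s \<otimes>\<^bsub>C\<^esub> cls t = (\<Union>s'\<in>cls s. \<Union>t'\<in>cls t. cls (TBr s' t'))"
    by (simp add: lie_coprod_def)
  also have "\<dots> = (\<Union>s'\<in>cls s. cls (TBr s' t))"
    using assms by (intro SUP_cong refl cls_lift cls_eqI cong_Br) (auto intro: cong_sym cong_refl dest: lie_cong_wf[OF M N])
  also have "\<dots> = cls (TBr s t)"
    using assms by (intro cls_lift cls_eqI cong_Br) (auto intro: cong_sym cong_refl)
  finally show ?thesis .
qed

private lemma smult_C [simp]:
  assumes "r \<in> carrier R" "wft s"
  shows "r \<odot>\<^bsub>C\<^esub> cls s = cls (TSmult r s)"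
proof -
  have "r \<odot>\<^bsub>C\<^esub> cls s = (\<Union>s'\<in>cls s. cls (TSmult r s'))"
    by (simp add: lie_coprod_def)
  also have "\<dots> = cls (TSmult r s)"
    using assms by (intro cls_lift cls_eqI cong_Smult) (auto intro: cong_sym)
  finally show ?thesis .
qed

private lemma zero_C [simp]: "\<zero>\<^bsub>C\<^esub> = cls TZero"
  by (simp add: lie_coprod_def)

lemma lie_coprod_lie_algebra: "lie_algebra R (lie_coprod R M N)"
proof -
  have carrierE: "(\<And>s. x = cls s \<Longrightarrow> wft s \<Longrightarrow> P) \<Longrightarrow> P" if "x \<in> carrier C" for x P
    using that by (auto simp: carrier_C)
  have ag: "abelian_group C"
  proof (rule abelian_groupI)
    fix x assume "x \<in> carrier C"
    then obtain s where s: "x = cls s" "wft s" by (rule carrierE)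
    have "cls (TSmult (\<ominus>\<^bsub>R\<^esub> \<one>\<^bsub>R\<^esub>) s) \<oplus>\<^bsub>C\<^esub> x = \<zero>\<^bsub>C\<^esub>"
      using s by (simp add: cls_eq_iff cong_add_neg)
    with s show "\<exists>y\<in>carrier C. y \<oplus>\<^bsub>C\<^esub> x = \<zero>\<^bsub>C\<^esub>"
      by (intro bexI[of _ "cls (TSmult (\<ominus>\<^bsub>R\<^esub> \<one>\<^bsub>R\<^esub>) s)"]) simp_all
  qed (elim carrierE; simp add: cls_eq_iff cong_add_assoc cong_add_comm cong_add_zero; fail | simp)+
  have "module R C"
    by (rule moduleI[OF M.is_cring ag]; elim carrierE;
        simp add: cls_eq_iff cong_smult_add_l cong_smult_add_r cong_smult_mult cong_smult_1)
  then show ?thesis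
    by (rule lie_algebra.intro, intro lie_algebra_axioms.intro; elim carrierE;
        simp add: cls_eq_iff cong_br_add_l cong_br_add_r cong_br_smult_l cong_br_smult_r
          cong_br_self cong_br_jacobi)
qed

lemma lie_inl_hom: "lie_inl R M N \<in> lie_hom R M (lie_coprod R M N)"
  by (simp add: lie_hom_def lie_inl_def cls_eq_iff cong_inl_add cong_inl_smult cong_inl_br)

lemma lie_inr_hom: "lie_inr R M N \<in> lie_hom R N (lie_coprod R M N)"
  by (simp add: lie_hom_def lie_inr_def cls_eq_iff cong_inr_add cong_inr_smult cong_inr_br)

lemma lie_eval_cong:
  assumes T: "lie_algebra R T" and f: "f \<in> lie_hom R M T" and g: "g \<in> lie_hom R N T"
    and st: "(s, t) \<in> lie_cong R M N"
  shows "lie_eval T f g s = lie_eval T f g t"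
proof -
  interpret T: lie_algebra R T by (rule T)
  have closed [simp]: "lie_eval T f g u \<in> carrier T" if "wft u" for u
    using that f g by (induction u) (auto simp: lie_hom_def)
  show ?thesis using st
  proof induction
    case (cong_add_neg s)
    then show ?case by (simp add: T.smult_l_minus T.l_neg)
  next
    case (cong_br_jacobi s t u)
    then show ?case by (simp add: T.jacobi)
  qed (use f g in \<open>auto simp: lie_hom_def T.a_ac T.smult_l_distr T.smult_r_distr
      T.smult_assoc1 T.bracket_add_l T.bracket_add_r T.bracket_smult_l T.bracket_smult_r\<close>)
qed

lemma lie_copair_class:
  assumes T: "lie_algebra R T" and f: "f \<in> lie_hom R M T" and g: "g \<in> lie_hom R N T"
    and s: "lie_term_wf R M N s"
  shows "lie_copair T f g (lie_class R M N s) = lie_eval T f g s"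
proof -
  have "lie_eval T f g ` cls s = {lie_eval T f g s}"
  proof (intro equalityI subsetI)
    fix y assume "y \<in> lie_eval T f g ` cls s"
    then obtain t where "(s, t) \<in> lie_cong R M N" "y = lie_eval T f g t" by auto
    then show "y \<in> {lie_eval T f g s}" using lie_eval_cong[OF T f g] by simp
  next
    fix y assume "y \<in> {lie_eval T f g s}"
    then show "y \<in> lie_eval T f g ` cls s" using s by (auto intro!: imageI cong_refl)
  qed
  then show ?thesis by (simp add: lie_copair_def)
qed

lemma lie_coprod_induct [consumes 1, case_names inl inr add smult bracket]:
  assumes "x \<in> carrier (lie_coprod R M N)"
    and "\<And>m. m \<in> carrier M \<Longrightarrow> P (lie_inl R M N m)"
    and "\<And>n. n \<in> carrier N \<Longrightarrow> P (lie_inr R M N n)"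
    and "\<And>x y. \<lbrakk>x \<in> carrier (lie_coprod R M N); y \<in> carrier (lie_coprod R M N); P x; P y\<rbrakk>
          \<Longrightarrow> P (x \<oplus>\<^bsub>lie_coprod R M N\<^esub> y)"
    and "\<And>r x. \<lbrakk>r \<in> carrier R; x \<in> carrier (lie_coprod R M N); P x\<rbrakk>
          \<Longrightarrow> P (r \<odot>\<^bsub>lie_coprod R M N\<^esub> x)"
    and "\<And>x y. \<lbrakk>x \<in> carrier (lie_coprod R M N); y \<in> carrier (lie_coprod R M N); P x; P y\<rbrakk>
          \<Longrightarrow> P (x \<otimes>\<^bsub>lie_coprod R M N\<^esub> y)"
  shows "P x"
proof -
  interpret C: lie_algebra R C by (rule lie_coprod_lie_algebra)
  have "P (cls s)" if "wft s" for s
    using that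
  proof (induction s)
    case TZero
    have "lie_inl R M N \<zero>\<^bsub>M\<^esub> \<in> carrier C" by (simp add: lie_inl_def)
    then have "\<zero>\<^bsub>R\<^esub> \<odot>\<^bsub>C\<^esub> lie_inl R M N \<zero>\<^bsub>M\<^esub> = cls TZero"
      using C.smult_l_null by (simp del: smult_C)
    then show ?case
      using assms(2,5) \<open>lie_inl R M N \<zero>\<^bsub>M\<^esub> \<in> carrier C\<close> M.zero_closed M.R.zero_closed by metis
  next
    case (TAdd s t) then show ?case using assms(4)[of "cls s" "cls t"] by simp
  next
    case (TSmult r s) then show ?case using assms(5)[of r "cls s"] by simp
  next
    case (TBr s t) then show ?case using assms(6)[of "cls s" "cls t"] by simp
  qed (use assms(2,3) in \<open>simp_all add: lie_inl_def lie_inr_def\<close>)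
  then show ?thesis using assms(1) by (auto simp: carrier_C)
qed

theorem lie_coprod_universal:
  assumes T: "lie_algebra R T" and f: "f \<in> lie_hom R M T" and g: "g \<in> lie_hom R N T"
  shows lie_copair_hom: "lie_copair T f g \<in> lie_hom R (lie_coprod R M N) T"
    and lie_copair_inl: "m \<in> carrier M \<Longrightarrow> lie_copair T f g (lie_inl R M N m) = f m"
    and lie_copair_inr: "n \<in> carrier N \<Longrightarrow> lie_copair T f g (lie_inr R M N n) = g n"
    and lie_copair_unique:
      "\<lbrakk>h \<in> lie_hom R (lie_coprod R M N) T;
        \<And>m. m \<in> carrier M \<Longrightarrow> h (lie_inl R M N m) = f m;
        \<And>n. n \<in> carrier N \<Longrightarrow> h (lie_inr R M N n) = g n;
        x \<in> carrier (lie_coprod R M N)\<rbrakk> \<Longrightarrow> h x = lie_copair T f g x"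
proof -
  interpret T: lie_algebra R T by (rule T)
  have closed [simp]: "lie_eval T f g u \<in> carrier T" if "wft u" for u
    using that f g by (induction u) (auto simp: lie_hom_def)
  note [simp] = lie_copair_class[OF T f g]
  show hom: "lie_copair T f g \<in> lie_hom R C T"
    by (auto simp: lie_hom_def carrier_C)
  show inl: "lie_copair T f g (lie_inl R M N m) = f m" if "m \<in> carrier M" for m
    using that by (simp add: lie_inl_def)
  show inr: "lie_copair T f g (lie_inr R M N n) = g n" if "n \<in> carrier N" for n
    using that by (simp add: lie_inr_def)
  show "h x = lie_copair T f g x"
    if h: "h \<in> lie_hom R C T" "\<And>m. m \<in> carrier M \<Longrightarrow> h (lie_inl R M N m) = f m"
      "\<And>n. n \<in> carrier N \<Longrightarrow> h (lie_inr R M N n) = g n" and x: "x \<in> carrier C" for x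
    using x by (induction rule: lie_coprod_induct) (use h hom inl inr in \<open>auto simp: lie_hom_def\<close>)
qed

lemma lie_term_act_cong:
  assumes "lie_action R L M \<phi>" and "lie_action R L N \<chi>" and l: "l \<in> carrier L"
    and st: "(s, t) \<in> lie_cong R M N"
  shows "lie_class R M N (lie_term_act \<phi> \<chi> l s) = lie_class R M N (lie_term_act \<phi> \<chi> l t)"
proof -
  interpret \<phi>: lie_action R L M \<phi> by fact
  interpret \<chi>: lie_action R L N \<chi> by fact
  interpret C: lie_algebra R C by (rule lie_coprod_lie_algebra)
  define D where "D s = cls (lie_term_act \<phi> \<chi> l s)" for s
  have act_wf [simp]: "wft (lie_term_act \<phi> \<chi> l u)" if "wft u" for u
    using that l by (induction u) (auto simp: \<phi>.act_closed \<chi>.act_closed)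
  have D_closed [simp]: "D u \<in> carrier C" if "wft u" for u
    using that by (simp add: D_def)
  have D_add: "D (TAdd u v) = D u \<oplus>\<^bsub>C\<^esub> D v" if "wft u" "wft v" for u v
    using that by (simp add: D_def)
  have D_smult: "D (TSmult r u) = r \<odot>\<^bsub>C\<^esub> D u" if "wft u" "r \<in> carrier R" for r u
    using that by (simp add: D_def)
  have D_br: "D (TBr u v) = (D u \<otimes>\<^bsub>C\<^esub> cls v) \<oplus>\<^bsub>C\<^esub> (cls u \<otimes>\<^bsub>C\<^esub> D v)" if "wft u" "wft v" for u v
    using that by (simp add: D_def)
  have D_zero: "D TZero = \<zero>\<^bsub>C\<^esub>" by (simp add: D_def)
  have c_add: "cls (TAdd u v) = cls u \<oplus>\<^bsub>C\<^esub> cls v" if "wft u" "wft v" for u v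
    using that by simp
  have c_smult: "cls (TSmult r u) = r \<odot>\<^bsub>C\<^esub> cls u" if "wft u" "r \<in> carrier R" for r u
    using that by simp
  have c_br: "cls (TBr u v) = cls u \<otimes>\<^bsub>C\<^esub> cls v" if "wft u" "wft v" for u v
    using that by simp
  note rules = D_add D_smult D_br D_zero c_add c_smult c_br
    C.smult_l_distr C.smult_r_distr C.smult_assoc1 C.bracket_add_l C.bracket_add_r
    C.bracket_smult_l C.bracket_smult_r
  have wf': "wft u \<and> wft v" if "(u, v) \<in> lie_cong R M N" for u v
    using lie_cong_wf[OF M N that] .
  note [simp del] = add_C smult_C mult_C zero_C cls_eq_iff
  have anti: "x \<otimes>\<^bsub>C\<^esub> y \<oplus>\<^bsub>C\<^esub> y \<otimes>\<^bsub>C\<^esub> x = \<zero>\<^bsub>C\<^esub>"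
    if "x \<in> carrier C" "y \<in> carrier C" for x y
  proof -
    have "\<zero>\<^bsub>C\<^esub> = (x \<oplus>\<^bsub>C\<^esub> y) \<otimes>\<^bsub>C\<^esub> (x \<oplus>\<^bsub>C\<^esub> y)"
      using that C.bracket_self[of "x \<oplus>\<^bsub>C\<^esub> y"] C.a_closed by metis
    also have "\<dots> = (x \<otimes>\<^bsub>C\<^esub> x \<oplus>\<^bsub>C\<^esub> x \<otimes>\<^bsub>C\<^esub> y) \<oplus>\<^bsub>C\<^esub> (y \<otimes>\<^bsub>C\<^esub> x \<oplus>\<^bsub>C\<^esub> y \<otimes>\<^bsub>C\<^esub> y)"
      using that by (simp add: C.bracket_add_l C.bracket_add_r C.a_ac del: C.bracket_self)
    also have "\<dots> = x \<otimes>\<^bsub>C\<^esub> y \<oplus>\<^bsub>C\<^esub> y \<otimes>\<^bsub>C\<^esub> x"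
      using that by simp
    finally show ?thesis by simp
  qed
  have "D s = D t" using st
  proof induction
    case (cong_Add s s' t t')
    then show ?case by (metis D_add wf')
  next
    case (cong_Smult r s s')
    then show ?case by (metis D_smult wf')
  next
    case (cong_Br s s' t t')
    then show ?case by (metis D_br wf' cls_eqI)
  next
    case (cong_add_neg s)
    then show ?case by (simp add: rules C.smult_l_minus C.l_neg)
  next
    case (cong_br_self s)
    then show ?case by (simp add: rules anti)
  next
    case (cong_br_jacobi s t u)
    have "D (TAdd (TAdd (TBr s (TBr t u)) (TBr t (TBr u s))) (TBr u (TBr s t)))
      = (D s \<otimes>\<^bsub>C\<^esub> (cls t \<otimes>\<^bsub>C\<^esub> cls u) \<oplus>\<^bsub>C\<^esub> cls t \<otimes>\<^bsub>C\<^esub> (cls u \<otimes>\<^bsub>C\<^esub> D s) \<oplus>\<^bsub>C\<^esub> cls u \<otimes>\<^bsub>C\<^esub> (D s \<otimes>\<^bsub>C\<^esub> cls t))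
      \<oplus>\<^bsub>C\<^esub> ((cls s \<otimes>\<^bsub>C\<^esub> (D t \<otimes>\<^bsub>C\<^esub> cls u) \<oplus>\<^bsub>C\<^esub> D t \<otimes>\<^bsub>C\<^esub> (cls u \<otimes>\<^bsub>C\<^esub> cls s) \<oplus>\<^bsub>C\<^esub> cls u \<otimes>\<^bsub>C\<^esub> (cls s \<otimes>\<^bsub>C\<^esub> D t))
      \<oplus>\<^bsub>C\<^esub> (cls s \<otimes>\<^bsub>C\<^esub> (cls t \<otimes>\<^bsub>C\<^esub> D u) \<oplus>\<^bsub>C\<^esub> cls t \<otimes>\<^bsub>C\<^esub> (D u \<otimes>\<^bsub>C\<^esub> cls s) \<oplus>\<^bsub>C\<^esub> D u \<otimes>\<^bsub>C\<^esub> (cls s \<otimes>\<^bsub>C\<^esub> cls t)))"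
      using cong_br_jacobi by (simp add: rules C.a_ac)
    also have "\<dots> = D TZero"
      using cong_br_jacobi C.jacobi by (simp add: rules)
    finally show ?case .
  next
    case (cong_inl_add m m')
    then show ?case using l by (simp add: D_def \<phi>.act_closed \<phi>.act_add_r add_C cls_eq_iff lie_cong.cong_inl_add)
  next
    case (cong_inl_smult a m)
    then show ?case using l by (simp add: D_def \<phi>.act_closed \<phi>.act_smult_r cls_eq_iff lie_cong.cong_inl_smult)
  next
    case (cong_inl_br m m')
    then have "D (TInl (m \<otimes>\<^bsub>M\<^esub> m')) = cls (TInl (\<phi> l m \<otimes>\<^bsub>M\<^esub> m')) \<oplus>\<^bsub>C\<^esub> cls (TInl (m \<otimes>\<^bsub>M\<^esub> \<phi> l m'))"
      using l by (simp add: D_def \<phi>.act_closed \<phi>.act_bracket_r add_C cls_eq_iff lie_cong.cong_inl_add)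
    also have "\<dots> = D (TBr (TInl m) (TInl m'))"
      using l cong_inl_br cls_eqI[OF lie_cong.cong_inl_br]
      by (simp add: D_def \<phi>.act_closed add_C[symmetric])
    finally show ?case .
  next
    case (cong_inr_add m m')
    then show ?case using l by (simp add: D_def \<chi>.act_closed \<chi>.act_add_r add_C cls_eq_iff lie_cong.cong_inr_add)
  next
    case (cong_inr_smult a m)
    then show ?case using l by (simp add: D_def \<chi>.act_closed \<chi>.act_smult_r cls_eq_iff lie_cong.cong_inr_smult)
  next
    case (cong_inr_br m m')
    then have "D (TInr (m \<otimes>\<^bsub>N\<^esub> m')) = cls (TInr (\<chi> l m \<otimes>\<^bsub>N\<^esub> m')) \<oplus>\<^bsub>C\<^esub> cls (TInr (m \<otimes>\<^bsub>N\<^esub> \<chi> l m'))"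
      using l by (simp add: D_def \<chi>.act_closed \<chi>.act_bracket_r add_C cls_eq_iff lie_cong.cong_inr_add)
    also have "\<dots> = D (TBr (TInr m) (TInr m'))"
      using l cong_inr_br cls_eqI[OF lie_cong.cong_inr_br]
      by (simp add: D_def \<chi>.act_closed add_C[symmetric])
    finally show ?case .
  qed (auto simp: rules C.a_ac)
  then show ?thesis by (simp add: D_def)
qed

theorem lie_coprod_action:
  assumes \<phi>: "lie_action R L M \<phi>" and \<chi>: "lie_action R L N \<chi>"
  shows lie_coprod_act_action: "lie_action R L (lie_coprod R M N) (lie_coprod_act R M N \<phi> \<chi>)"
    and lie_coprod_act_inl: "\<lbrakk>l \<in> carrier L; m \<in> carrier M\<rbrakk>
      \<Longrightarrow> lie_coprod_act R M N \<phi> \<chi> l (lie_inl R M N m) = lie_inl R M N (\<phi> l m)"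
    and lie_coprod_act_inr: "\<lbrakk>l \<in> carrier L; n \<in> carrier N\<rbrakk>
      \<Longrightarrow> lie_coprod_act R M N \<phi> \<chi> l (lie_inr R M N n) = lie_inr R M N (\<chi> l n)"
    and lie_coprod_act_unique:
      "\<lbrakk>lie_action R L (lie_coprod R M N) \<theta>;
        \<And>l m. \<lbrakk>l \<in> carrier L; m \<in> carrier M\<rbrakk> \<Longrightarrow> \<theta> l (lie_inl R M N m) = lie_inl R M N (\<phi> l m);
        \<And>l n. \<lbrakk>l \<in> carrier L; n \<in> carrier N\<rbrakk> \<Longrightarrow> \<theta> l (lie_inr R M N n) = lie_inr R M N (\<chi> l n);
        l \<in> carrier L; x \<in> carrier (lie_coprod R M N)\<rbrakk>
      \<Longrightarrow> \<theta> l x = lie_coprod_act R M N \<phi> \<chi> l x"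
proof -
  interpret \<phi>: lie_action R L M \<phi> by fact
  interpret \<chi>: lie_action R L N \<chi> by fact
  interpret C: lie_algebra R C by (rule lie_coprod_lie_algebra)
  let ?A = "lie_coprod_act R M N \<phi> \<chi>"
  have act_wf [simp]: "wft (lie_term_act \<phi> \<chi> l u)" if "wft u" "l \<in> carrier L" for u l
    using that by (induction u) (auto simp: \<phi>.act_closed \<chi>.act_closed)
  have A_cls: "?A l (cls s) = cls (lie_term_act \<phi> \<chi> l s)" if "wft s" "l \<in> carrier L" for s l
    unfolding lie_coprod_act_def
    using cls_lift[OF that(1)] lie_term_act_cong[OF \<phi> \<chi> that(2)] by metis
  show A_inl: "?A l (lie_inl R M N m) = lie_inl R M N (\<phi> l m)"
    if "l \<in> carrier L" "m \<in> carrier M" for l m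
    using that by (simp add: lie_inl_def A_cls)
  show A_inr: "?A l (lie_inr R M N n) = lie_inr R M N (\<chi> l n)"
    if "l \<in> carrier L" "n \<in> carrier N" for l n
    using that by (simp add: lie_inr_def A_cls)
  have closed [simp, intro]: "?A l x \<in> carrier C" if "l \<in> carrier L" "x \<in> carrier C" for l x
    using that by (auto simp: carrier_C A_cls)
  have A_add: "?A l (x \<oplus>\<^bsub>C\<^esub> y) = ?A l x \<oplus>\<^bsub>C\<^esub> ?A l y"
    if "l \<in> carrier L" "x \<in> carrier C" "y \<in> carrier C" for l x y
    using that by (auto simp: carrier_C A_cls)
  have A_smult: "?A l (r \<odot>\<^bsub>C\<^esub> x) = r \<odot>\<^bsub>C\<^esub> ?A l x"
    if "r \<in> carrier R" "l \<in> carrier L" "x \<in> carrier C" for l r x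
    using that by (auto simp: carrier_C A_cls)
  have A_br: "?A l (x \<otimes>\<^bsub>C\<^esub> y) = (?A l x \<otimes>\<^bsub>C\<^esub> y) \<oplus>\<^bsub>C\<^esub> (x \<otimes>\<^bsub>C\<^esub> ?A l y)"
    if "l \<in> carrier L" "x \<in> carrier C" "y \<in> carrier C" for l x y
    using that by (auto simp: carrier_C A_cls)
  have inl_cl [simp, intro]: "lie_inl R M N m \<in> carrier C" if "m \<in> carrier M" for m
    using that by (simp add: lie_inl_def)
  have inr_cl [simp, intro]: "lie_inr R M N n \<in> carrier C" if "n \<in> carrier N" for n
    using that by (simp add: lie_inr_def)
  have inl_hom: "lie_inl R M N (m \<oplus>\<^bsub>M\<^esub> m') = lie_inl R M N m \<oplus>\<^bsub>C\<^esub> lie_inl R M N m'"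
     "r \<in> carrier R \<Longrightarrow> lie_inl R M N (r \<odot>\<^bsub>M\<^esub> m) = r \<odot>\<^bsub>C\<^esub> lie_inl R M N m"
    if "m \<in> carrier M" "m' \<in> carrier M" for m m' r
    using that lie_inl_hom by (auto simp: lie_hom_def)
  have inr_hom: "lie_inr R M N (m \<oplus>\<^bsub>N\<^esub> m') = lie_inr R M N m \<oplus>\<^bsub>C\<^esub> lie_inr R M N m'"
     "r \<in> carrier R \<Longrightarrow> lie_inr R M N (r \<odot>\<^bsub>N\<^esub> m) = r \<odot>\<^bsub>C\<^esub> lie_inr R M N m"
    if "m \<in> carrier N" "m' \<in> carrier N" for m m' r
    using that lie_inr_hom by (auto simp: lie_hom_def)
  note [simp del] = add_C smult_C mult_C zero_C cls_eq_iff
  have add_l: "?A (l \<oplus>\<^bsub>L\<^esub> l') x = ?A l x \<oplus>\<^bsub>C\<^esub> ?A l' x"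
    if l: "l \<in> carrier L" "l' \<in> carrier L" and x: "x \<in> carrier C" for l l' x
    using x by (induction rule: lie_coprod_induct)
      (use l in \<open>simp_all add: A_inl A_inr A_add A_smult A_br inl_hom inr_hom \<phi>.act_closed \<chi>.act_closed
        \<phi>.act_add_l \<chi>.act_add_l C.smult_r_distr C.bracket_add_l C.bracket_add_r C.a_ac\<close>)
  have smult_l: "?A (r \<odot>\<^bsub>L\<^esub> l) x = r \<odot>\<^bsub>C\<^esub> ?A l x"
    if l: "l \<in> carrier L" and r: "r \<in> carrier R" and x: "x \<in> carrier C" for l r x
    using x
  proof (induction rule: lie_coprod_induct)
    case (smult a x)
    have "?A (r \<odot>\<^bsub>L\<^esub> l) (a \<odot>\<^bsub>C\<^esub> x) = (a \<otimes>\<^bsub>R\<^esub> r) \<odot>\<^bsub>C\<^esub> ?A l x"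
      using smult l r by (simp add: A_smult C.smult_assoc1)
    also have "\<dots> = (r \<otimes>\<^bsub>R\<^esub> a) \<odot>\<^bsub>C\<^esub> ?A l x"
      using smult r by (simp add: M.R.m_comm)
    also have "\<dots> = r \<odot>\<^bsub>C\<^esub> ?A l (a \<odot>\<^bsub>C\<^esub> x)"
      using smult l r by (simp add: A_smult C.smult_assoc1)
    finally show ?case .
  qed (use l r in \<open>simp_all add: A_inl A_inr A_add A_br inl_hom inr_hom \<phi>.act_closed \<chi>.act_closed
        \<phi>.act_smult_l \<chi>.act_smult_l C.smult_r_distr C.bracket_smult_l C.bracket_smult_r\<close>)
  have minus: "y = u \<ominus>\<^bsub>C\<^esub> v \<longleftrightarrow> y \<oplus>\<^bsub>C\<^esub> v = u"
    if "y \<in> carrier C" "u \<in> carrier C" "v \<in> carrier C" for y u v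
    using that by (metis C.add.inv_solve_right C.minus_eq)
  have inl_minus: "lie_inl R M N (u \<ominus>\<^bsub>M\<^esub> v) \<oplus>\<^bsub>C\<^esub> lie_inl R M N v = lie_inl R M N u"
    if "u \<in> carrier M" "v \<in> carrier M" for u v
    using that by (metis inl_hom(1) M.add.inv_solve_right M.minus_eq M.minus_closed)
  have inr_minus: "lie_inr R M N (u \<ominus>\<^bsub>N\<^esub> v) \<oplus>\<^bsub>C\<^esub> lie_inr R M N v = lie_inr R M N u"
    if "u \<in> carrier N" "v \<in> carrier N" for u v
    using that by (metis inr_hom(1) N.add.inv_solve_right N.minus_eq N.minus_closed)
  have br_l: "?A (l \<otimes>\<^bsub>L\<^esub> l') x \<oplus>\<^bsub>C\<^esub> ?A l' (?A l x) = ?A l (?A l' x)"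
    if l: "l \<in> carrier L" "l' \<in> carrier L" and x: "x \<in> carrier C" for l l' x
    using x
  proof (induction rule: lie_coprod_induct)
    case (inl m)
    then show ?case
      using l by (simp add: A_inl \<phi>.act_closed \<phi>.act_bracket_l inl_minus)
  next
    case (inr m)
    then show ?case
      using l by (simp add: A_inr \<chi>.act_closed \<chi>.act_bracket_l inr_minus)
  next
    case (add x y)
    then show ?case
      using l by (simp add: A_add add.IH[symmetric] C.a_ac)
  next
    case (smult r x)
    then show ?case
      using l by (simp add: A_smult smult.IH[symmetric] C.smult_r_distr)
  next
    case (bracket x y)
    then show ?case
      using l by (simp add: A_add A_br bracket.IH[symmetric] C.bracket_add_l C.bracket_add_r C.a_ac)
  qed
  show act: "lie_action R L C ?A"
    by unfold_locales (simp_all add: A_add A_smult A_br add_l smult_l minus br_l)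
  show "\<theta> l x = ?A l x"
    if \<theta>: "lie_action R L C \<theta>"
      "\<And>l m. \<lbrakk>l \<in> carrier L; m \<in> carrier M\<rbrakk> \<Longrightarrow> \<theta> l (lie_inl R M N m) = lie_inl R M N (\<phi> l m)"
      "\<And>l n. \<lbrakk>l \<in> carrier L; n \<in> carrier N\<rbrakk> \<Longrightarrow> \<theta> l (lie_inr R M N n) = lie_inr R M N (\<chi> l n)"
      and l: "l \<in> carrier L" and x: "x \<in> carrier C" for \<theta> l x
  proof -
    interpret \<theta>: lie_action R L C \<theta> by fact
    show ?thesis using x
      by (induction rule: lie_coprod_induct)
        (use l in \<open>simp_all add: \<theta>(2,3) A_inl A_inr A_add A_smult A_br \<theta>.act_add_r \<theta>.act_smult_r \<theta>.act_bracket_r\<close>)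
  qed
qed

end


section \<open>The Peiffer product\<close>

text \<open>
  Throughout, \<open>\<alpha> m n\<close> is the action of \<open>m \<in> M\<close> on \<open>n \<in> N\<close> and \<open>\<beta> n m\<close> is the action
  of \<open>n \<in> N\<close> on \<open>m \<in> M\<close>.
\<close>

definition peiffer_ideal ::
    "('r, 'x) ring_scheme \<Rightarrow> ('r, 'm, 'y) module_scheme \<Rightarrow> ('r, 'n, 'z) module_scheme
      \<Rightarrow> ('m \<Rightarrow> 'n \<Rightarrow> 'n) \<Rightarrow> ('n \<Rightarrow> 'm \<Rightarrow> 'm) \<Rightarrow> ('r, 'm, 'n) lie_term set set"
  where "peiffer_ideal R M N \<alpha> \<beta> = gen_lie_ideal R (lie_coprod R M N)
    ({lie_inl R M N (\<beta> n m) \<ominus>\<^bsub>lie_coprod R M N\<^esub>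
        (lie_inr R M N n \<otimes>\<^bsub>lie_coprod R M N\<^esub> lie_inl R M N m)
        | m n. m \<in> carrier M \<and> n \<in> carrier N} \<union>
     {lie_inr R M N (\<alpha> m n) \<ominus>\<^bsub>lie_coprod R M N\<^esub>
        (lie_inl R M N m \<otimes>\<^bsub>lie_coprod R M N\<^esub> lie_inr R M N n)
        | m n. m \<in> carrier M \<and> n \<in> carrier N})"

definition peiffer_product ::
    "('r, 'x) ring_scheme \<Rightarrow> ('r, 'm, 'y) module_scheme \<Rightarrow> ('r, 'n, 'z) module_scheme
      \<Rightarrow> ('m \<Rightarrow> 'n \<Rightarrow> 'n) \<Rightarrow> ('n \<Rightarrow> 'm \<Rightarrow> 'm) \<Rightarrow> ('r, ('r, 'm, 'n) lie_term set set) module"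
  where "peiffer_product R M N \<alpha> \<beta> = lie_quot (lie_coprod R M N) (peiffer_ideal R M N \<alpha> \<beta>)"

definition peiffer_proj ::
    "('r, 'x) ring_scheme \<Rightarrow> ('r, 'm, 'y) module_scheme \<Rightarrow> ('r, 'n, 'z) module_scheme
      \<Rightarrow> ('m \<Rightarrow> 'n \<Rightarrow> 'n) \<Rightarrow> ('n \<Rightarrow> 'm \<Rightarrow> 'm)
      \<Rightarrow> ('r, 'm, 'n) lie_term set \<Rightarrow> ('r, 'm, 'n) lie_term set set"
  where "peiffer_proj R M N \<alpha> \<beta> s = peiffer_ideal R M N \<alpha> \<beta> +>\<^bsub>lie_coprod R M N\<^esub> s"

definition peiffer_act ::
    "('r, 'x) ring_scheme \<Rightarrow> ('r, 'm, 'y) module_scheme \<Rightarrow> ('r, 'n, 'z) module_scheme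
      \<Rightarrow> ('m \<Rightarrow> 'n \<Rightarrow> 'n) \<Rightarrow> ('n \<Rightarrow> 'm \<Rightarrow> 'm) \<Rightarrow> ('l \<Rightarrow> 'm \<Rightarrow> 'm) \<Rightarrow> ('l \<Rightarrow> 'n \<Rightarrow> 'n)
      \<Rightarrow> 'l \<Rightarrow> ('r, 'm, 'n) lie_term set set \<Rightarrow> ('r, 'm, 'n) lie_term set set"
  where "peiffer_act R M N \<alpha> \<beta> \<phi> \<chi> l X =
    (\<Union>s\<in>X. peiffer_proj R M N \<alpha> \<beta> (lie_coprod_act R M N \<phi> \<chi> l s))"

definition peiffer_copair ::
    "('r, 'c, 'w) module_scheme \<Rightarrow> ('m \<Rightarrow> 'c) \<Rightarrow> ('n \<Rightarrow> 'c)
      \<Rightarrow> ('r, 'm, 'n) lie_term set set \<Rightarrow> 'c"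
  where "peiffer_copair T f g X = the_elem (lie_copair T f g ` X)"

end

theory Submission
  imports Defs
begin

text \<open>
  Write \<open>f\<close> for the morphism $M + N \to L$ induced by $\mu$ and $\nu$. Equivariance of \<open>f\<close> and the
  Peiffer identity are checked on generators and propagated along brackets by the Jacobi identity.
  The action sends a generator ${}^{n}m - [n,m]$ of $K$ to
  $({}^{n'}m - [n',m]) + ({}^{n}m' - [n,m'])$ with $n' = {}^{l}n$, $m' = {}^{l}m$, so it preserves $K$.
  For the Peiffer identity ${}^{f(s)}t \equiv [s,t]$ modulo $K$: if $s$ and $t$ are both in $M$ or both
  in $N$ it is the Peiffer identity of that crossed module, and in the mixed cases the difference is a
  generator of $K$. For fixed $s$ both sides are derivations in $t$; for fixed $t$ both sides are the
  value at $t$ of a Lie morphism from $M + N$ to the derivations of $M \bowtie N$.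
\<close>

section \<open>Bracket identities and generated ideals in a Lie algebra\<close>

lemma (in abelian_group) minus_eq_zero_iff:
  assumes "x \<in> carrier G" "y \<in> carrier G"
  shows "x \<ominus> y = \<zero> \<longleftrightarrow> x = y"
  using assms by (metis add.inv_solve_right l_zero minus_eq zero_closed)

context lie_algebra
begin

lemma bracket_zero_r [simp]: "x \<in> carrier L \<Longrightarrow> x \<otimes>\<^bsub>L\<^esub> \<zero>\<^bsub>L\<^esub> = \<zero>\<^bsub>L\<^esub>"
  using bracket_smult_r[of "\<zero>\<^bsub>R\<^esub>" x x] by simp

lemma bracket_minus_l:
  assumes "x \<in> carrier L" "y \<in> carrier L"
  shows "(\<ominus>\<^bsub>L\<^esub> x) \<otimes>\<^bsub>L\<^esub> y = \<ominus>\<^bsub>L\<^esub> (x \<otimes>\<^bsub>L\<^esub> y)"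
  using bracket_smult_l[of "\<ominus>\<^bsub>R\<^esub> \<one>\<^bsub>R\<^esub>" x y] assms by (simp add: smult_l_minus)

lemma bracket_minus_r:
  assumes "x \<in> carrier L" "y \<in> carrier L"
  shows "x \<otimes>\<^bsub>L\<^esub> (\<ominus>\<^bsub>L\<^esub> y) = \<ominus>\<^bsub>L\<^esub> (x \<otimes>\<^bsub>L\<^esub> y)"
  using bracket_smult_r[of "\<ominus>\<^bsub>R\<^esub> \<one>\<^bsub>R\<^esub>" x y] assms by (simp add: smult_l_minus)

text \<open>Polarisation: expand \<open>[x + y, x + y] = 0\<close> and drop the squares.\<close>

lemma bracket_anticommute:
  assumes "x \<in> carrier L" "y \<in> carrier L"
  shows "x \<otimes>\<^bsub>L\<^esub> y = \<ominus>\<^bsub>L\<^esub> (y \<otimes>\<^bsub>L\<^esub> x)"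
proof -
  have "\<zero>\<^bsub>L\<^esub> = (x \<oplus>\<^bsub>L\<^esub> y) \<otimes>\<^bsub>L\<^esub> (x \<oplus>\<^bsub>L\<^esub> y)"
    using assms bracket_self[of "x \<oplus>\<^bsub>L\<^esub> y"] M.a_closed by metis
  also have "\<dots> = (x \<otimes>\<^bsub>L\<^esub> x \<oplus>\<^bsub>L\<^esub> x \<otimes>\<^bsub>L\<^esub> y) \<oplus>\<^bsub>L\<^esub> (y \<otimes>\<^bsub>L\<^esub> x \<oplus>\<^bsub>L\<^esub> y \<otimes>\<^bsub>L\<^esub> y)"
    using assms by (simp add: bracket_add_l bracket_add_r M.a_ac del: bracket_self)
  also have "\<dots> = x \<otimes>\<^bsub>L\<^esub> y \<oplus>\<^bsub>L\<^esub> y \<otimes>\<^bsub>L\<^esub> x"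
    using assms by simp
  finally show ?thesis
    using assms M.minus_equality by (metis bracket_closed)
qed

text \<open>This is the Jacobi identity with its second and third terms flipped by
  anticommutativity. In this form, bracketing with \<open>x\<close> obeys the same Leibniz rule as
  \<open>act_bracket_r\<close>.\<close>

lemma bracket_derivation:
  assumes "x \<in> carrier L" "y \<in> carrier L" "z \<in> carrier L"
  shows "x \<otimes>\<^bsub>L\<^esub> (y \<otimes>\<^bsub>L\<^esub> z) = (x \<otimes>\<^bsub>L\<^esub> y) \<otimes>\<^bsub>L\<^esub> z \<oplus>\<^bsub>L\<^esub> y \<otimes>\<^bsub>L\<^esub> (x \<otimes>\<^bsub>L\<^esub> z)"
proof -
  have "y \<otimes>\<^bsub>L\<^esub> (z \<otimes>\<^bsub>L\<^esub> x) = \<ominus>\<^bsub>L\<^esub> (y \<otimes>\<^bsub>L\<^esub> (x \<otimes>\<^bsub>L\<^esub> z))"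
    using assms bracket_anticommute[of z x] by (simp add: bracket_minus_r)
  moreover have "z \<otimes>\<^bsub>L\<^esub> (x \<otimes>\<^bsub>L\<^esub> y) = \<ominus>\<^bsub>L\<^esub> ((x \<otimes>\<^bsub>L\<^esub> y) \<otimes>\<^bsub>L\<^esub> z)"
    using assms bracket_anticommute[of z "x \<otimes>\<^bsub>L\<^esub> y"] by simp
  ultimately have "x \<otimes>\<^bsub>L\<^esub> (y \<otimes>\<^bsub>L\<^esub> z) \<ominus>\<^bsub>L\<^esub> ((x \<otimes>\<^bsub>L\<^esub> y) \<otimes>\<^bsub>L\<^esub> z \<oplus>\<^bsub>L\<^esub> y \<otimes>\<^bsub>L\<^esub> (x \<otimes>\<^bsub>L\<^esub> z)) = \<zero>\<^bsub>L\<^esub>"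
    using assms jacobi[of x y z] by (simp add: M.minus_eq M.minus_add M.a_ac)
  then show ?thesis
    using assms by (simp add: M.minus_eq_zero_iff)
qed

text \<open>The Leibniz rule solved for its first summand. It is the counterpart of
  \<open>act_bracket_l\<close>: the adjoint map turns brackets into commutators.\<close>

lemma bracket_bracket_l:
  assumes "x \<in> carrier L" "y \<in> carrier L" "z \<in> carrier L"
  shows "(x \<otimes>\<^bsub>L\<^esub> y) \<otimes>\<^bsub>L\<^esub> z = x \<otimes>\<^bsub>L\<^esub> (y \<otimes>\<^bsub>L\<^esub> z) \<ominus>\<^bsub>L\<^esub> y \<otimes>\<^bsub>L\<^esub> (x \<otimes>\<^bsub>L\<^esub> z)"
  using assms bracket_derivation[of x y z] by (simp add: M.minus_eq M.a_assoc M.r_neg)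

text \<open>The whole carrier is an ideal containing \<open>S\<close>, so the intersection runs over
  a nonempty family and stays inside the carrier.\<close>

lemma lie_ideal_gen:
  assumes "S \<subseteq> carrier L"
  shows "lie_ideal (gen_lie_ideal R L S) R L"
proof -
  have car: "lie_ideal (carrier L) R L"
    by (simp add: lie_ideal_def carrier_is_submodule)
  have "submodule (gen_lie_ideal R L S) R L"
  proof (rule submoduleI)
    show "gen_lie_ideal R L S \<subseteq> carrier L"
      using car assms by (auto simp: gen_lie_ideal_def)
    show "\<zero>\<^bsub>L\<^esub> \<in> gen_lie_ideal R L S"
      by (auto simp: gen_lie_ideal_def lie_ideal_def submodule_def dest: subgroup.one_closed)
  qed (auto simp: gen_lie_ideal_def lie_ideal_def submoduleE)
  then show ?thesis
    by (auto simp: lie_ideal_def gen_lie_ideal_def)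
qed

end

lemma subset_gen_lie_ideal: "S \<subseteq> gen_lie_ideal R A S"
  by (auto simp: gen_lie_ideal_def)

lemma gen_lie_ideal_least: "lie_ideal I R A \<Longrightarrow> S \<subseteq> I \<Longrightarrow> gen_lie_ideal R A S \<subseteq> I"
  by (auto simp: gen_lie_ideal_def)

section \<open>Linear maps, morphisms and actions\<close>

lemma lie_homD:
  assumes "f \<in> lie_hom R A B"
  shows "x \<in> carrier A \<Longrightarrow> f x \<in> carrier B"
    and "x \<in> carrier A \<Longrightarrow> y \<in> carrier A \<Longrightarrow> f (x \<oplus>\<^bsub>A\<^esub> y) = f x \<oplus>\<^bsub>B\<^esub> f y"
    and "r \<in> carrier R \<Longrightarrow> x \<in> carrier A \<Longrightarrow> f (r \<odot>\<^bsub>A\<^esub> x) = r \<odot>\<^bsub>B\<^esub> f x"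
    and "x \<in> carrier A \<Longrightarrow> y \<in> carrier A \<Longrightarrow> f (x \<otimes>\<^bsub>A\<^esub> y) = f x \<otimes>\<^bsub>B\<^esub> f y"
  using assms by (auto simp: lie_hom_def)

text \<open>Zero and negatives are multiples by 0 and -1, so linearity suffices. The map is not
  assumed to preserve brackets, which lets the result apply both to morphisms and to the derivations
  \<open>\<psi> p\<close>.\<close>

lemma linear_map_facts:
  assumes A: "module R A" and B: "module R B"
    and closed: "\<And>x. x \<in> carrier A \<Longrightarrow> f x \<in> carrier B"
    and add: "\<And>x y. x \<in> carrier A \<Longrightarrow> y \<in> carrier A \<Longrightarrow> f (x \<oplus>\<^bsub>A\<^esub> y) = f x \<oplus>\<^bsub>B\<^esub> f y"
    and smult: "\<And>r x. r \<in> carrier R \<Longrightarrow> x \<in> carrier A \<Longrightarrow> f (r \<odot>\<^bsub>A\<^esub> x) = r \<odot>\<^bsub>B\<^esub> f x"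
  shows linear_zero: "f \<zero>\<^bsub>A\<^esub> = \<zero>\<^bsub>B\<^esub>"
    and linear_uminus: "x \<in> carrier A \<Longrightarrow> f (\<ominus>\<^bsub>A\<^esub> x) = \<ominus>\<^bsub>B\<^esub> f x"
    and linear_diff: "x \<in> carrier A \<Longrightarrow> y \<in> carrier A \<Longrightarrow> f (x \<ominus>\<^bsub>A\<^esub> y) = f x \<ominus>\<^bsub>B\<^esub> f y"
proof -
  interpret A: module R A by fact
  interpret B: module R B by fact
  show "f \<zero>\<^bsub>A\<^esub> = \<zero>\<^bsub>B\<^esub>"
    using smult[of "\<zero>\<^bsub>R\<^esub>" "\<zero>\<^bsub>A\<^esub>"] closed by simp
  show uminus: "f (\<ominus>\<^bsub>A\<^esub> x) = \<ominus>\<^bsub>B\<^esub> f x" if "x \<in> carrier A" for x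
    using smult[of "\<ominus>\<^bsub>R\<^esub> \<one>\<^bsub>R\<^esub>" x] closed that by (simp add: A.smult_l_minus B.smult_l_minus)
  show "f (x \<ominus>\<^bsub>A\<^esub> y) = f x \<ominus>\<^bsub>B\<^esub> f y" if "x \<in> carrier A" "y \<in> carrier A"
    using that by (simp add: A.minus_eq B.minus_eq add uminus)
qed

lemma lie_hom_diff:
  assumes "lie_algebra R A" "lie_algebra R B" "f \<in> lie_hom R A B"
    and "x \<in> carrier A" "y \<in> carrier A"
  shows "f (x \<ominus>\<^bsub>A\<^esub> y) = f x \<ominus>\<^bsub>B\<^esub> f y"
  using assms by (intro linear_diff) (auto simp: lie_homD dest: lie_algebra.axioms)

lemma (in lie_action) act_diff_r:
  assumes "p \<in> carrier P" "x \<in> carrier M" "y \<in> carrier M"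
  shows "\<psi> p (x \<ominus>\<^bsub>M\<^esub> y) = \<psi> p x \<ominus>\<^bsub>M\<^esub> \<psi> p y"
  using assms
  by (intro linear_diff[OF M.module_axioms M.module_axioms])
     (auto simp: act_closed act_add_r act_smult_r)

lemma (in lie_action) act_zero_r:
  assumes "p \<in> carrier P"
  shows "\<psi> p \<zero>\<^bsub>M\<^esub> = \<zero>\<^bsub>M\<^esub>"
  using assms act_smult_r[of "\<zero>\<^bsub>R\<^esub>" p "\<zero>\<^bsub>M\<^esub>"] act_closed by simp

lemma (in lie_action) act_uminus_r:
  assumes "p \<in> carrier P" "x \<in> carrier M"
  shows "\<psi> p (\<ominus>\<^bsub>M\<^esub> x) = \<ominus>\<^bsub>M\<^esub> \<psi> p x"
  using assms
  by (intro linear_uminus[OF M.module_axioms M.module_axioms])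
     (auto simp: act_closed act_add_r act_smult_r)

text \<open>The elements of the ideal that \<open>p\<close> maps back into it form an ideal, by the Leibniz rule.\<close>

lemma (in lie_action) act_gen_lie_ideal:
  assumes S: "S \<subseteq> carrier M" and p: "p \<in> carrier P"
    and gen: "\<And>s. s \<in> S \<Longrightarrow> \<psi> p s \<in> gen_lie_ideal R M S"
    and x: "x \<in> gen_lie_ideal R M S"
  shows "\<psi> p x \<in> gen_lie_ideal R M S"
proof -
  let ?I = "gen_lie_ideal R M S"
  have I: "submodule ?I R M" "\<And>x y. x \<in> carrier M \<Longrightarrow> y \<in> ?I \<Longrightarrow> x \<otimes>\<^bsub>M\<^esub> y \<in> ?I"
    using M.lie_ideal_gen[OF S] by (auto simp: lie_ideal_def)
  note IE = M.submoduleE[OF I(1)]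
  have zero: "\<zero>\<^bsub>M\<^esub> \<in> ?I"
    using I(1) by (auto simp: submodule_def dest: subgroup.one_closed)
  have "submodule {y \<in> ?I. \<psi> p y \<in> ?I} R M"
    using p IE zero
    by (intro M.submoduleI) (auto simp: act_add_r act_smult_r act_uminus_r act_zero_r subset_iff)
  \<comment> \<open>The Leibniz rule yields \<open>[p y, z] + [y, p z]\<close>. The first summand
    needs \<open>z\<close> in the ideal and the second needs \<open>p z\<close> there, so the set
    must impose both conditions.\<close>
  moreover have "\<psi> p (y \<otimes>\<^bsub>M\<^esub> z) \<in> ?I" if "y \<in> carrier M" "z \<in> ?I" "\<psi> p z \<in> ?I" for y z
    using that p IE(1,5) by (auto simp: act_bracket_r act_closed I(2) subset_iff)
  ultimately have "lie_ideal {y \<in> ?I. \<psi> p y \<in> ?I} R M"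
    using I(2) by (auto simp: lie_ideal_def)
  then have "?I \<subseteq> {y \<in> ?I. \<psi> p y \<in> ?I}"
    using gen subset_gen_lie_ideal[of S R M] by (intro gen_lie_ideal_least) auto
  with x show ?thesis by auto
qed

text \<open>Together with \<open>gen_lie_ideal_least\<close> this reduces vanishing on a generated
  ideal to vanishing on its generators.\<close>

lemma lie_ideal_kernel:
  assumes "lie_algebra R A" "lie_algebra R B" and f: "f \<in> lie_hom R A B"
  shows "lie_ideal {x \<in> carrier A. f x = \<zero>\<^bsub>B\<^esub>} R A"
proof -
  interpret A: lie_algebra R A by fact
  interpret B: lie_algebra R B by fact
  note f_simps = lie_homD[OF f]
  have "f \<zero>\<^bsub>A\<^esub> = \<zero>\<^bsub>B\<^esub>" "x \<in> carrier A \<Longrightarrow> f (\<ominus>\<^bsub>A\<^esub> x) = \<ominus>\<^bsub>B\<^esub> f x" for x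
    using linear_zero[OF A.module_axioms B.module_axioms, of f]
      linear_uminus[OF A.module_axioms B.module_axioms, of f] f_simps by auto
  then show ?thesis
    unfolding lie_ideal_def by (intro conjI A.submoduleI) (auto simp: f_simps)
qed

section \<open>The quotient of a Lie algebra by an ideal\<close>

locale lie_quotient = lie_algebra R A for R (structure) and A (structure) +
  fixes I
  assumes lie_ideal: "lie_ideal I R A"
begin

abbreviation "Q \<equiv> lie_quot A I"
abbreviation "q x \<equiv> I +>\<^bsub>A\<^esub> x"

lemma submod: "submodule I R A"
  using lie_ideal by (simp add: lie_ideal_def)

sublocale I: abelian_subgroup I A
  using submod M.abelian_group_axioms
  by (intro abelian_subgroupI3 additive_subgroupI) (auto simp: submodule_def)

lemma ideal_carrier [simp]: "x \<in> I \<Longrightarrow> x \<in> carrier A"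
  using I.a_subset by auto

lemma ideal_smult: "r \<in> carrier R \<Longrightarrow> x \<in> I \<Longrightarrow> r \<odot>\<^bsub>A\<^esub> x \<in> I"
  using submoduleE(4)[OF submod] .

lemma ideal_bracket_r: "x \<in> carrier A \<Longrightarrow> y \<in> I \<Longrightarrow> x \<otimes>\<^bsub>A\<^esub> y \<in> I"
  using lie_ideal by (simp add: lie_ideal_def)

text \<open>\<open>lie_ideal\<close> asks for closure on one side; anticommutativity supplies the
  other.\<close>

lemma ideal_bracket_l: "x \<in> I \<Longrightarrow> y \<in> carrier A \<Longrightarrow> x \<otimes>\<^bsub>A\<^esub> y \<in> I"
  using ideal_bracket_r[of y x] bracket_anticommute[of x y] by simp

lemma q_eq_iff:
  assumes "x \<in> carrier A" "y \<in> carrier A"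
  shows "q x = q y \<longleftrightarrow> x \<ominus>\<^bsub>A\<^esub> y \<in> I"
  using assms I.a_rcos_module[of y x, folded M.minus_eq] I.a_rcos_self[of x]
    M.a_repr_independence[OF _ _ I.a_subgroup, of x y] by blast

text \<open>Maps on the quotient are written as unions over all representatives. The union of a
  nonempty family of equal sets is their common value, so only independence of the representative
  remains to be shown.\<close>

lemma q_lift:
  assumes "x \<in> carrier A"
    and "\<And>y. y \<in> carrier A \<Longrightarrow> y \<ominus>\<^bsub>A\<^esub> x \<in> I \<Longrightarrow> F y = F x"
  shows "(\<Union>y\<in>q x. F y) = F x"
proof -
  have "x \<in> q x" using assms(1) by (rule I.a_rcos_self)
  moreover have "F y = F x" if "y \<in> q x" for y
  proof (rule assms(2))
    show "y \<in> carrier A"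
      using that assms(1) M.a_r_coset_subset_G[OF I.a_subset] by blast
    then show "y \<ominus>\<^bsub>A\<^esub> x \<in> I"
      using that assms(1) I.a_rcos_module[of x y] by (simp add: M.minus_eq)
  qed
  ultimately show ?thesis by (intro UN_constant_eq) blast+
qed

lemma carrier_Q: "carrier Q = q ` carrier A"
  by (auto simp: lie_quot_def A_RCOSETS_def')

lemma carrier_QE:
  assumes "X \<in> carrier Q"
  obtains x where "x \<in> carrier A" "X = q x"
  using assms by (auto simp: carrier_Q)

lemma q_closed [simp, intro]: "x \<in> carrier A \<Longrightarrow> q x \<in> carrier Q"
  by (simp add: carrier_Q)

lemma zero_Q: "\<zero>\<^bsub>Q\<^esub> = q \<zero>\<^bsub>A\<^esub>"
  by (simp add: lie_quot_def M.a_coset_add_zero I.a_subset)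

lemma add_Q: "x \<in> carrier A \<Longrightarrow> y \<in> carrier A \<Longrightarrow> q x \<oplus>\<^bsub>Q\<^esub> q y = q (x \<oplus>\<^bsub>A\<^esub> y)"
  by (simp add: lie_quot_def I.a_rcos_sum)

lemma smult_Q:
  assumes "r \<in> carrier R" "x \<in> carrier A"
  shows "r \<odot>\<^bsub>Q\<^esub> q x = q (r \<odot>\<^bsub>A\<^esub> x)"
proof -
  have "q (r \<odot>\<^bsub>A\<^esub> y) = q (r \<odot>\<^bsub>A\<^esub> x)" if "y \<in> carrier A" "y \<ominus>\<^bsub>A\<^esub> x \<in> I" for y
    using ideal_smult[OF assms(1) that(2)] that assms
    by (simp add: q_eq_iff M.minus_eq smult_r_distr smult_r_minus)
  then show ?thesis
    using assms by (simp add: lie_quot_def q_lift[where F = "\<lambda>x. q (r \<odot>\<^bsub>A\<^esub> x)"])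
qed

lemma bracket_Q:
  assumes "x \<in> carrier A" "y \<in> carrier A"
  shows "q x \<otimes>\<^bsub>Q\<^esub> q y = q (x \<otimes>\<^bsub>A\<^esub> y)"
proof -
  \<comment> \<open>Representatives are changed one factor at a time: \<open>r\<close> replaces the
    right one for any left factor, then \<open>l\<close> replaces the left one. The errors
    \<open>[z, w - y]\<close> and \<open>[z - x, y]\<close> lie in the ideal.\<close>
  have r: "q (z \<otimes>\<^bsub>A\<^esub> w) = q (z \<otimes>\<^bsub>A\<^esub> y)"
    if "z \<in> carrier A" "w \<in> carrier A" "w \<ominus>\<^bsub>A\<^esub> y \<in> I" for z w
    using ideal_bracket_r[OF that(1,3)] that assms
    by (simp add: q_eq_iff M.minus_eq bracket_add_r bracket_minus_r)
  have l: "q (z \<otimes>\<^bsub>A\<^esub> y) = q (x \<otimes>\<^bsub>A\<^esub> y)" if "z \<in> carrier A" "z \<ominus>\<^bsub>A\<^esub> x \<in> I" for z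
    using ideal_bracket_l[OF that(2) assms(2)] that assms
    by (simp add: q_eq_iff M.minus_eq bracket_add_l bracket_minus_l)
  have "q x \<subseteq> carrier A"
    using assms M.a_r_coset_subset_G[OF I.a_subset] by blast
  then have "q x \<otimes>\<^bsub>Q\<^esub> q y = (\<Union>z\<in>q x. q (z \<otimes>\<^bsub>A\<^esub> y))"
    using assms r unfolding lie_quot_def rcoset_mult_def
    by (auto intro!: SUP_cong q_lift simp: subset_iff)
  also have "\<dots> = q (x \<otimes>\<^bsub>A\<^esub> y)"
    using assms l by (intro q_lift)
  finally show ?thesis .
qed

lemma lie_algebra_quot: "lie_algebra R Q"
proof -
  note ops = add_Q smult_Q bracket_Q zero_Q
  have ag: "abelian_group Q"
  proof (rule abelian_groupI)
    fix X assume "X \<in> carrier Q"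
    then obtain x where "x \<in> carrier A" "X = q x" by (auto simp: carrier_Q)
    then show "\<exists>Y\<in>carrier Q. Y \<oplus>\<^bsub>Q\<^esub> X = \<zero>\<^bsub>Q\<^esub>"
      by (intro bexI[of _ "q (\<ominus>\<^bsub>A\<^esub> x)"]) (auto simp: ops M.l_neg)
  qed (elim carrier_QE; simp add: ops M.a_ac; fail | simp add: zero_Q)+
  have "module R Q"
    by (rule moduleI[OF R.is_cring ag])
       (elim carrier_QE; simp add: ops smult_l_distr smult_r_distr smult_assoc1)+
  then show ?thesis
    by (rule lie_algebra.intro, intro lie_algebra_axioms.intro)
       (elim carrier_QE; simp add: ops bracket_add_l bracket_add_r bracket_smult_l bracket_smult_r jacobi)+
qed

lemma q_hom: "(\<lambda>x. q x) \<in> lie_hom R A Q"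
  by (auto simp: lie_hom_def add_Q smult_Q bracket_Q)

lemma diff_Q: "x \<in> carrier A \<Longrightarrow> y \<in> carrier A \<Longrightarrow> q x \<ominus>\<^bsub>Q\<^esub> q y = q (x \<ominus>\<^bsub>A\<^esub> y)"
  using lie_hom_diff[OF lie_algebra_axioms lie_algebra_quot q_hom] by simp

text \<open>Representatives differing by an element of \<open>I\<close> have images differing by an
  element of \<open>I\<close>, since \<open>\<theta> p\<close> is additive and preserves
  \<open>I\<close>. All axioms of an action are then inherited through representatives.\<close>

lemma action_quot:
  assumes act: "lie_action R P A \<theta>"
    and inv: "\<And>p x. p \<in> carrier P \<Longrightarrow> x \<in> I \<Longrightarrow> \<theta> p x \<in> I"
  shows act_quot_q: "p \<in> carrier P \<Longrightarrow> x \<in> carrier A \<Longrightarrow> (\<Union>s\<in>q x. q (\<theta> p s)) = q (\<theta> p x)"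
    and lie_action_quot: "lie_action R P Q (\<lambda>p X. \<Union>s\<in>X. q (\<theta> p s))"
proof -
  interpret \<theta>: lie_action R P A \<theta> by fact
  interpret Q: lie_algebra R Q by (rule lie_algebra_quot)
  show act_q: "(\<Union>s\<in>q x. q (\<theta> p s)) = q (\<theta> p x)" if "p \<in> carrier P" "x \<in> carrier A" for p x
  proof (rule q_lift)
    fix y assume "y \<in> carrier A" "y \<ominus>\<^bsub>A\<^esub> x \<in> I"
    then show "q (\<theta> p y) = q (\<theta> p x)"
      using inv[of p "y \<ominus>\<^bsub>A\<^esub> x"] that by (simp add: q_eq_iff \<theta>.act_closed \<theta>.act_diff_r)
  qed fact
  note ops = add_Q smult_Q bracket_Q diff_Q act_q \<theta>.act_closed
  show "lie_action R P Q (\<lambda>p X. \<Union>s\<in>X. q (\<theta> p s))"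
    by unfold_locales
       (elim carrier_QE; simp add: ops \<theta>.act_add_l \<theta>.act_add_r \<theta>.act_smult_l \<theta>.act_smult_r
         \<theta>.act_bracket_l \<theta>.act_bracket_r)+
qed

text \<open>As \<open>f\<close> kills \<open>I\<close>, it is constant on each coset; the image of a
  coset is a singleton, from which \<open>the_elem\<close> reads the value.\<close>

lemma hom_quot:
  assumes T: "lie_algebra R T" and f: "f \<in> lie_hom R A T"
    and ker: "\<And>x. x \<in> I \<Longrightarrow> f x = \<zero>\<^bsub>T\<^esub>"
  shows hom_quot_q: "x \<in> carrier A \<Longrightarrow> the_elem (f ` q x) = f x"
    and lie_hom_quot: "(\<lambda>X. the_elem (f ` X)) \<in> lie_hom R Q T"
proof -
  interpret T: lie_algebra R T by fact
  note f_simps = lie_homD[OF f]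
  show hom_q: "the_elem (f ` q x) = f x" if x: "x \<in> carrier A" for x
  proof -
    \<comment> \<open>Values are wrapped in singletons because \<open>q_lift\<close> speaks of
      unions of sets.\<close>
    have "{f y} = {f x}" if "y \<in> carrier A" "y \<ominus>\<^bsub>A\<^esub> x \<in> I" for y
    proof -
      have "f y \<ominus>\<^bsub>T\<^esub> f x = \<zero>\<^bsub>T\<^esub>"
        using ker[OF that(2)] lie_hom_diff[OF lie_algebra_axioms T f] that x by simp
      then show ?thesis using that x f_simps(1) by (simp add: T.minus_eq_zero_iff)
    qed
    then have "(\<Union>y\<in>q x. {f y}) = {f x}"
      using x by (intro q_lift)
    then have "f ` q x = {f x}" by blast
    then show ?thesis by simp
  qed
  show "(\<lambda>X. the_elem (f ` X)) \<in> lie_hom R Q T"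
    by (auto simp: lie_hom_def carrier_Q add_Q smult_Q bracket_Q hom_q f_simps)
qed

end

section \<open>The crossed module on the Peiffer product\<close>

theorem proposition3p3:
  fixes R :: "('r, 'x) ring_scheme"
    and L :: "('r, 'l, 'y) module_scheme"
    and M :: "('r, 'm, 'z) module_scheme"
    and N :: "('r, 'n, 'w) module_scheme"
    and \<mu> :: "'m \<Rightarrow> 'l" and \<nu> :: "'n \<Rightarrow> 'l"
    and \<psi>\<^sub>M :: "'l \<Rightarrow> 'm \<Rightarrow> 'm" and \<psi>\<^sub>N :: "'l \<Rightarrow> 'n \<Rightarrow> 'n"
  assumes "lie_crossed_module R M L \<mu> \<psi>\<^sub>M"
    and "lie_crossed_module R N L \<nu> \<psi>\<^sub>N"
  shows "lie_crossed_module R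
           (peiffer_product R M N (\<lambda>m n. \<psi>\<^sub>N (\<mu> m) n) (\<lambda>n m. \<psi>\<^sub>M (\<nu> n) m))
           L
           (peiffer_copair L \<mu> \<nu>)
           (peiffer_act R M N (\<lambda>m n. \<psi>\<^sub>N (\<mu> m) n) (\<lambda>n m. \<psi>\<^sub>M (\<nu> n) m) \<psi>\<^sub>M \<psi>\<^sub>N)"
proof -
  interpret \<mu>: lie_crossed_module R M L \<mu> \<psi>\<^sub>M by fact
  interpret \<nu>: lie_crossed_module R N L \<nu> \<psi>\<^sub>N by fact
  note Mlie = \<mu>.M.lie_algebra_axioms and Nlie = \<nu>.M.lie_algebra_axioms
    and Llie = \<mu>.P.lie_algebra_axioms
  define \<alpha> where "\<alpha> = (\<lambda>m n. \<psi>\<^sub>N (\<mu> m) n)"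
  define \<beta> where "\<beta> = (\<lambda>n m. \<psi>\<^sub>M (\<nu> n) m)"
  define C where "C = lie_coprod R M N"
  define i where "i = lie_inl R M N"
  define j where "j = lie_inr R M N"
  define \<theta> where "\<theta> = lie_coprod_act R M N \<psi>\<^sub>M \<psi>\<^sub>N"
  define f where "f = lie_copair L \<mu> \<nu>"
  define K where "K = peiffer_ideal R M N \<alpha> \<beta>"
  define S where "S = {i (\<beta> n m) \<ominus>\<^bsub>C\<^esub> (j n \<otimes>\<^bsub>C\<^esub> i m) | m n. m \<in> carrier M \<and> n \<in> carrier N} \<union>
     {j (\<alpha> m n) \<ominus>\<^bsub>C\<^esub> (i m \<otimes>\<^bsub>C\<^esub> j n) | m n. m \<in> carrier M \<and> n \<in> carrier N}"
  have K_gen: "K = gen_lie_ideal R C S"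
    by (simp add: K_def S_def peiffer_ideal_def C_def i_def j_def)
  note coprod_induct = lie_coprod_induct[OF Mlie Nlie, folded C_def i_def j_def,
      consumes 1, case_names inl inr add smult bracket]
  note \<mu>_hom = lie_homD[OF \<mu>.boundary_hom] and \<nu>_hom = lie_homD[OF \<nu>.boundary_hom]
  note i_hom = lie_homD[OF lie_inl_hom[OF Mlie Nlie], folded C_def i_def]
  note j_hom = lie_homD[OF lie_inr_hom[OF Mlie Nlie], folded C_def j_def]
  note acts = \<mu>.lie_action_axioms \<nu>.lie_action_axioms
  interpret C: lie_algebra R C
    unfolding C_def by (rule lie_coprod_lie_algebra[OF Mlie Nlie])
  interpret \<theta>: lie_action R L C \<theta>
    unfolding C_def \<theta>_def by (rule lie_coprod_act_action[OF Mlie Nlie acts])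
  have \<theta>_i: "\<theta> l (i m) = i (\<psi>\<^sub>M l m)" if "l \<in> carrier L" "m \<in> carrier M" for l m
    using lie_coprod_act_inl[OF Mlie Nlie acts that] by (simp add: \<theta>_def i_def)
  have \<theta>_j: "\<theta> l (j n) = j (\<psi>\<^sub>N l n)" if "l \<in> carrier L" "n \<in> carrier N" for l n
    using lie_coprod_act_inr[OF Mlie Nlie acts that] by (simp add: \<theta>_def j_def)
  note copair = lie_coprod_universal[OF Mlie Nlie Llie \<mu>.boundary_hom \<nu>.boundary_hom,
      folded C_def f_def i_def j_def]
  note f_hom = lie_homD[OF copair(1)]
  have f_equivariant: "f (\<theta> l s) = l \<otimes>\<^bsub>L\<^esub> f s"
    if l: "l \<in> carrier L" and s: "s \<in> carrier C" for l s
    using s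
  proof (induction rule: coprod_induct)
    \<comment> \<open>Applying \<open>\<theta> l\<close> in the coproduct and bracketing with
      \<open>l\<close> in \<open>L\<close> follow the same Leibniz rule.\<close>
    case (bracket x y)
    then show ?case
      using l \<mu>.P.bracket_derivation[of l "f x" "f y"]
      by (simp add: \<theta>.act_bracket_r \<theta>.act_closed f_hom)
  qed (use l in \<open>simp_all add: \<theta>_i \<theta>_j copair(2,3) \<mu>.act_closed \<nu>.act_closed
      \<mu>.boundary_equivariant \<nu>.boundary_equivariant \<theta>.act_add_r \<theta>.act_smult_r \<theta>.act_closed f_hom
      \<mu>_hom \<nu>_hom \<mu>.P.bracket_add_r \<mu>.P.bracket_smult_r\<close>)

  have \<alpha>_closed: "\<alpha> m n \<in> carrier N" and \<beta>_closed: "\<beta> n m \<in> carrier M"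
    if "m \<in> carrier M" "n \<in> carrier N" for m n
    using that by (auto simp: \<alpha>_def \<beta>_def \<mu>.act_closed \<nu>.act_closed \<mu>_hom \<nu>_hom)
  have S_carrier: "S \<subseteq> carrier C"
    by (auto simp: S_def \<alpha>_closed \<beta>_closed i_hom j_hom)
  have "lie_ideal K R C"
    unfolding K_gen by (rule C.lie_ideal_gen[OF S_carrier])
  \<comment> \<open>From here on \<open>K.q\<close> is the quotient map and \<open>K.Q\<close> the
    Peiffer product.\<close>
  then interpret K: lie_quotient R C K
    by unfold_locales
  have S_K: "S \<subseteq> K"
    unfolding K_gen by (rule subset_gen_lie_ideal)

  \<comment> \<open>Vanishing of the induced morphism on \<open>K\<close>\<close>
  have "f s = \<zero>\<^bsub>L\<^esub>" if "s \<in> S" for s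
  proof -
    \<comment> \<open>By equivariance of \<open>\<mu>\<close>, \<open>f\<close> sends
      \<open>i (\<beta> n m)\<close> to \<open>[\<nu> n, \<mu> m]\<close>, which is also its value
      at \<open>[j n, i m]\<close>. The other generators use equivariance of
      \<open>\<nu>\<close>.\<close>
    have "f (i (\<beta> n m) \<ominus>\<^bsub>C\<^esub> (j n \<otimes>\<^bsub>C\<^esub> i m)) = \<zero>\<^bsub>L\<^esub>"
      "f (j (\<alpha> m n) \<ominus>\<^bsub>C\<^esub> (i m \<otimes>\<^bsub>C\<^esub> j n)) = \<zero>\<^bsub>L\<^esub>" if "m \<in> carrier M" "n \<in> carrier N" for m n
      using that
      by (simp_all add: lie_hom_diff[OF C.lie_algebra_axioms Llie copair(1)] \<alpha>_closed \<beta>_closed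
          i_hom j_hom f_hom copair(2,3))
        (simp_all add: \<alpha>_def \<beta>_def \<mu>_hom \<nu>_hom \<mu>.boundary_equivariant \<nu>.boundary_equivariant
          \<mu>.P.M.minus_eq_zero_iff)
    with that show ?thesis by (auto simp: S_def)
  qed
  \<comment> \<open>The kernel of \<open>f\<close> is an ideal containing \<open>S\<close>, hence
    contains \<open>K\<close>.\<close>
  then have f_K: "f s = \<zero>\<^bsub>L\<^esub>" if "s \<in> K" for s
    using gen_lie_ideal_least[OF lie_ideal_kernel[OF C.lie_algebra_axioms Llie copair(1)], of S]
      that S_carrier by (auto simp: K_gen)

  \<comment> \<open>Invariance of \<open>K\<close> under \<open>L\<close>\<close>
  have \<theta>_S: "\<theta> l s \<in> K" if l: "l \<in> carrier L" and "s \<in> S" for l s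
  proof -
    have gen_i: "i (\<beta> n m) \<ominus>\<^bsub>C\<^esub> (j n \<otimes>\<^bsub>C\<^esub> i m) \<in> K"
      and gen_j: "j (\<alpha> m n) \<ominus>\<^bsub>C\<^esub> (i m \<otimes>\<^bsub>C\<^esub> j n) \<in> K" if "m \<in> carrier M" "n \<in> carrier N" for m n
      using that S_K by (auto simp: S_def)
    have i_case: "\<theta> l (i (\<beta> n m) \<ominus>\<^bsub>C\<^esub> (j n \<otimes>\<^bsub>C\<^esub> i m)) \<in> K"
      if mn: "m \<in> carrier M" "n \<in> carrier N" for m n
    proof -
      let ?m = "\<psi>\<^sub>M l m" and ?n = "\<psi>\<^sub>N l n"
      have cl: "?m \<in> carrier M" "?n \<in> carrier N"
        using mn l by (simp_all add: \<mu>.act_closed \<nu>.act_closed)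
      \<comment> \<open>Since \<open>\<nu> ?n = [l, \<nu> n]\<close>, the element
        \<open>\<beta> ?n m\<close> is the commutator of the actions of \<open>l\<close> and
        \<open>\<nu> n\<close> at \<open>m\<close>; adding \<open>\<beta> n ?m\<close> cancels its
        second term.\<close>
      have "\<psi>\<^sub>M l (\<beta> n m) = \<beta> ?n m \<oplus>\<^bsub>M\<^esub> \<beta> n ?m"
        using mn l cl \<mu>.act_bracket_l[of l "\<nu> n" m]
        by (simp add: \<beta>_def \<nu>.boundary_equivariant \<mu>.act_closed \<nu>_hom \<mu>.M.minus_eq \<mu>.M.a_assoc \<mu>.M.l_neg)
      then have "\<theta> l (i (\<beta> n m) \<ominus>\<^bsub>C\<^esub> (j n \<otimes>\<^bsub>C\<^esub> i m)) =
        (i (\<beta> ?n m) \<ominus>\<^bsub>C\<^esub> (j ?n \<otimes>\<^bsub>C\<^esub> i m)) \<oplus>\<^bsub>C\<^esub> (i (\<beta> n ?m) \<ominus>\<^bsub>C\<^esub> (j n \<otimes>\<^bsub>C\<^esub> i ?m))"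
        using mn l cl
        by (simp add: \<theta>.act_add_r \<theta>.act_uminus_r \<theta>.act_bracket_r \<theta>.act_closed
            \<theta>_i \<theta>_j i_hom j_hom \<beta>_closed
            C.minus_eq C.minus_add C.a_ac)
      then show ?thesis
        using gen_i mn cl by simp
    qed
    have j_case: "\<theta> l (j (\<alpha> m n) \<ominus>\<^bsub>C\<^esub> (i m \<otimes>\<^bsub>C\<^esub> j n)) \<in> K"
      if mn: "m \<in> carrier M" "n \<in> carrier N" for m n
    proof -
      let ?m = "\<psi>\<^sub>M l m" and ?n = "\<psi>\<^sub>N l n"
      have cl: "?m \<in> carrier M" "?n \<in> carrier N"
        using mn l by (simp_all add: \<mu>.act_closed \<nu>.act_closed)
      have "\<psi>\<^sub>N l (\<alpha> m n) = \<alpha> ?m n \<oplus>\<^bsub>N\<^esub> \<alpha> m ?n"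
        using mn l cl \<nu>.act_bracket_l[of l "\<mu> m" n]
        by (simp add: \<alpha>_def \<mu>.boundary_equivariant \<nu>.act_closed \<mu>_hom \<nu>.M.minus_eq \<nu>.M.a_assoc \<nu>.M.l_neg)
      then have "\<theta> l (j (\<alpha> m n) \<ominus>\<^bsub>C\<^esub> (i m \<otimes>\<^bsub>C\<^esub> j n)) =
        (j (\<alpha> ?m n) \<ominus>\<^bsub>C\<^esub> (i ?m \<otimes>\<^bsub>C\<^esub> j n)) \<oplus>\<^bsub>C\<^esub> (j (\<alpha> m ?n) \<ominus>\<^bsub>C\<^esub> (i m \<otimes>\<^bsub>C\<^esub> j ?n))"
        using mn l cl
        by (simp add: \<theta>.act_add_r \<theta>.act_uminus_r \<theta>.act_bracket_r \<theta>.act_closed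
            \<theta>_i \<theta>_j i_hom j_hom \<alpha>_closed
            C.minus_eq C.minus_add C.a_ac)
      then show ?thesis
        using gen_j mn cl by simp
    qed
    from \<open>s \<in> S\<close> show ?thesis
      unfolding S_def using i_case j_case by auto
  qed
  have \<theta>_K: "\<theta> l s \<in> K" if "l \<in> carrier L" "s \<in> K" for l s
    using \<theta>.act_gen_lie_ideal[OF S_carrier] \<theta>_S that unfolding K_gen by blast

  \<comment> \<open>The induced action and morphism on the quotient\<close>
  define \<Psi> where "\<Psi> = (\<lambda>l X. \<Union>s\<in>X. K.q (\<theta> l s))"
  define F where "F = (\<lambda>X. the_elem (f ` X))"
  interpret Q: lie_algebra R K.Q
    by (rule K.lie_algebra_quot)
  interpret \<Psi>: lie_action R L K.Q \<Psi>
    unfolding \<Psi>_def by (rule K.lie_action_quot[OF \<theta>.lie_action_axioms \<theta>_K])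
  have \<Psi>_q: "\<Psi> l (K.q s) = K.q (\<theta> l s)" if "l \<in> carrier L" "s \<in> carrier C" for l s
    unfolding \<Psi>_def by (rule K.act_quot_q[OF \<theta>.lie_action_axioms \<theta>_K that])
  have F_q: "F (K.q s) = f s" if "s \<in> carrier C" for s
    unfolding F_def by (rule K.hom_quot_q[OF Llie copair(1) f_K that])
  have F_hom: "F \<in> lie_hom R K.Q L"
    unfolding F_def by (rule K.lie_hom_quot[OF Llie copair(1) f_K])

  \<comment> \<open>The Peiffer identity\<close>
  have peiffer_i: "K.q (i (\<beta> n m)) = K.q (j n \<otimes>\<^bsub>C\<^esub> i m)"
    and peiffer_j: "K.q (j (\<alpha> m n)) = K.q (i m \<otimes>\<^bsub>C\<^esub> j n)"
    if "m \<in> carrier M" "n \<in> carrier N" for m n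
    using that S_K by (auto simp: K.q_eq_iff \<alpha>_closed \<beta>_closed i_hom j_hom S_def)
  have extend_r: "K.q (\<theta> (f s) t) = K.q (s \<otimes>\<^bsub>C\<^esub> t)"
    if s: "s \<in> carrier C" and t: "t \<in> carrier C"
      and gen_i: "\<And>m. m \<in> carrier M \<Longrightarrow> K.q (\<theta> (f s) (i m)) = K.q (s \<otimes>\<^bsub>C\<^esub> i m)"
      and gen_j: "\<And>n. n \<in> carrier N \<Longrightarrow> K.q (\<theta> (f s) (j n)) = K.q (s \<otimes>\<^bsub>C\<^esub> j n)" for s t
    using t
    \<comment> \<open>both sides are derivations in \<open>t\<close>\<close>
  proof (induction rule: coprod_induct)
    case (bracket x y)
    \<comment> \<open>Expressing sums and brackets of cosets in \<open>K.Q\<close> lets the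
      hypotheses for \<open>x\<close> and \<open>y\<close> act inside the Leibniz expansion;
      \<open>bracket_derivation\<close> then reassembles \<open>[s, [x, y]]\<close>.\<close>
    then have "K.q (\<theta> (f s) (x \<otimes>\<^bsub>C\<^esub> y)) = K.q (s \<otimes>\<^bsub>C\<^esub> x \<otimes>\<^bsub>C\<^esub> y \<oplus>\<^bsub>C\<^esub> x \<otimes>\<^bsub>C\<^esub> (s \<otimes>\<^bsub>C\<^esub> y))"
      using s by (simp add: \<theta>.act_bracket_r \<theta>.act_closed f_hom K.add_Q[symmetric] K.bracket_Q[symmetric])
    then show ?case
      using s bracket C.bracket_derivation[of s x y] by simp
  qed (use s in \<open>simp_all add: gen_i gen_j \<theta>.act_add_r \<theta>.act_smult_r \<theta>.act_closed f_hom
      C.bracket_add_r C.bracket_smult_r K.add_Q[symmetric] K.smult_Q[symmetric]\<close>)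
  have peiffer: "\<Psi> (f s) (K.q t) = K.q s \<otimes>\<^bsub>K.Q\<^esub> K.q t"
    if s: "s \<in> carrier C" and t: "t \<in> carrier C" for s t
    using s t
  \<comment> \<open>\<open>t\<close> must vary: the bracket case uses the hypothesis for
    \<open>x\<close> at \<open>[y, t]\<close> and the one for \<open>y\<close> at
    \<open>[x, t]\<close>.\<close>
  proof (induction arbitrary: t rule: coprod_induct)
    case (inl m)
    \<comment> \<open>By \<open>extend_r\<close> it is enough to take \<open>t\<close> in
      \<open>M\<close>, where the Peiffer identity of \<open>\<mu>\<close> applies, or in
      \<open>N\<close>, where \<open>peiffer_j\<close> does.\<close>
    have "K.q (\<theta> (f (i m)) t) = K.q (i m \<otimes>\<^bsub>C\<^esub> t)"
      by (rule extend_r)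
        (use inl in \<open>simp_all add: copair(2,3) \<theta>_i \<theta>_j i_hom \<mu>_hom \<mu>.peiffer_identity
          peiffer_j[symmetric, unfolded \<alpha>_def]\<close>)
    then show ?case
      using inl by (simp add: \<Psi>_q f_hom i_hom K.bracket_Q)
  next
    case (inr n)
    have "K.q (\<theta> (f (j n)) t) = K.q (j n \<otimes>\<^bsub>C\<^esub> t)"
      by (rule extend_r)
        (use inr in \<open>simp_all add: copair(2,3) \<theta>_i \<theta>_j j_hom \<nu>_hom \<nu>.peiffer_identity
          peiffer_i[symmetric, unfolded \<beta>_def]\<close>)
    then show ?case
      using inr by (simp add: \<Psi>_q f_hom j_hom K.bracket_Q)
  next
    case (add x y)
    then show ?case
      by (simp add: f_hom K.add_Q[symmetric] \<Psi>.act_add_l Q.bracket_add_l)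
  next
    case (smult r x)
    then show ?case
      by (simp add: f_hom K.smult_Q[symmetric] \<Psi>.act_smult_l Q.bracket_smult_l)
  next
    case (bracket x y)
    then have "\<Psi> (f x) (\<Psi> (f y) (K.q t)) = K.q x \<otimes>\<^bsub>K.Q\<^esub> (K.q y \<otimes>\<^bsub>K.Q\<^esub> K.q t)"
      "\<Psi> (f y) (\<Psi> (f x) (K.q t)) = K.q y \<otimes>\<^bsub>K.Q\<^esub> (K.q x \<otimes>\<^bsub>K.Q\<^esub> K.q t)"
      using bracket.IH(1)[of "y \<otimes>\<^bsub>C\<^esub> t"] bracket.IH(2)[of "x \<otimes>\<^bsub>C\<^esub> t"]
      by (simp_all add: K.bracket_Q)
    \<comment> \<open>The action of \<open>[f x, f y]\<close> is a commutator by
      \<open>act_bracket_l\<close>, and \<open>bracket_bracket_l\<close> writes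
      \<open>[[x, y], t]\<close> as the matching commutator of brackets.\<close>
    with bracket(1,2) bracket.prems show ?case
      by (simp add: f_hom K.bracket_Q[symmetric] \<Psi>.act_bracket_l Q.bracket_bracket_l)
  qed
  have "lie_crossed_module R K.Q L F \<Psi>"
  proof unfold_locales
    show "F \<in> lie_hom R K.Q L" by (rule F_hom)
  \<comment> \<open>The remaining axioms are checked on representatives; the reversed
    \<open>peiffer\<close> turns brackets in \<open>K.Q\<close> into values of
    \<open>\<Psi>\<close>.\<close>
  qed (auto simp: K.carrier_Q F_q \<Psi>_q peiffer[symmetric] f_equivariant \<theta>.act_closed f_hom)
  moreover have "K.Q = peiffer_product R M N \<alpha> \<beta>"
    by (simp add: peiffer_product_def K_def C_def)
  moreover have "\<Psi> = peiffer_act R M N \<alpha> \<beta> \<psi>\<^sub>M \<psi>\<^sub>N"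
    by (intro ext) (simp add: \<Psi>_def peiffer_act_def peiffer_proj_def K_def C_def \<theta>_def)
  moreover have "F = peiffer_copair L \<mu> \<nu>"
    by (intro ext) (simp add: F_def f_def peiffer_copair_def)
  ultimately show ?thesis
    by (simp add: \<alpha>_def \<beta>_def)
qed

end
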